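(* Assume that $\mathbb{K}$ is endowed with a series derivation $d$ of Hardy type, $a\mapsto a'$. Let $\tilde\theta$ be the greatest lower bound, with respect to $\preccurlyeq$, of the set $\{\theta^{(\phi)}:\phi\in\Phi\}$ in $\Gamma$, if it exists. Then any element $a\in\mathbb{K}$ with $a\prec\tilde\theta$ admits an integral in $\mathbb{K}$. Moreover, $\mathbb{K}$ is closed under integration (every element of $\mathbb{K}$ admits an integral in $\mathbb{K}$) if and only if $\tilde\theta\notin\Gamma$, i.e. the set $\{\theta^{(\phi)}:\phi\in\Phi\}$ has no greatest lower bound in $\Gamma$.
   Context: Let $(\Phi,\preccurlyeq)$ be a totally ordered set (the fundamental monomials). A set is anti-well-ordered if each nonempty subset has a greatest element. The Hahn group $\mathbf{H}(\Phi)$ is the set of formal products $\gamma=\prod_{\phi\in\Phi}\phi^{\gamma_\phi}$ with $\gamma_\phi\in\mathbb{R}$ and $\mathrm{supp}\,\gamma:=\{\phi\in\Phi:\gamma_\phi\neq 0\}$ anti-well-ordered in $\Phi$; multiplication adds exponents pointwise, and $\gamma\succ 1$ iff $\gamma_\phi>0$ for $\phi=\max(\mathrm{supp}\,\gamma)$. This is a totally ordered abelian group, with $\Phi\subset\mathbf{H}(\Phi)$ as ordered set and $\phi\succ1$ for all $\phi\in\Phi$. Fix a subgroup $\Gamma$ of $\mathbf{H}(\Phi)$ with $\Phi\subset\Gamma$. For $\gamma\in\Gamma\setminus\{1\}$ put $\mathrm{LF}(\gamma):=\max(\mathrm{supp}\,\gamma)\in\Phi$, and $\mathrm{LF}(1):=1$.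 $\mathbb{K}:=\mathbb{R}((\Gamma))$ is the field of generalised series $a=\sum_{\alpha}a_\alpha\alpha$, i.e. maps $a:\Gamma\to\mathbb{R}$ whose support $\mathrm{Supp}\,a=\{\alpha\in\Gamma: a_\alpha\ne0\}$ is anti-well-ordered in $\Gamma$, with componentwise sum and convolution product. For $a\ne0$, $\mathrm{LM}(a):=\max(\mathrm{Supp}\,a)$, and $\mathrm{LM}(0):=0\prec\gamma$ for all $\gamma\in\Gamma$; $\mathbb{K}$ is ordered by the sign of the coefficient of $\mathrm{LM}(a)$, and $|a|=\max(a,-a)$. Define $a\preccurlyeq b\Leftrightarrow\mathrm{LM}(a)\preccurlyeq\mathrm{LM}(b)$ (and $\prec$ correspondingly), and $a\asymp b\Leftrightarrow\mathrm{LM}(a)=\mathrm{LM}(b)$. For $a\neq0$, $\mathrm{LF}(a):=\mathrm{LF}(\mathrm{LM}(a))$; two elements $a,b\succ1$ are comparable iff $\mathrm{LF}(a)=\mathrm{LF}(b)$. A family $(a_i)_{i\in I}$ in $\mathbb{K}$ is summable if $\bigcup_i\mathrm{Supp}\,a_i$ is anti-well-ordered in $\Gamma$ and for each $\alpha$ the set $\{i\in I:\alpha\in\mathrm{Supp}\,a_i\}$ is finite; its sum is then defined coefficientwise. A series derivation on $\mathbb{K}$ is a map $\mathbb{K}\to\mathbb{K}$, $a\mapsto a'$, such that: (D0) $1'=0$; (D1) for every $\alpha=\prod_\phi\phi^{\alpha_\phi}\in\Gamma$ the family $(\frac{\phi'}{\phi})_{\phi\in\mathrm{supp}\,\alpha}$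 is summable and $\alpha'=\alpha\sum_{\phi\in\mathrm{supp}\,\alpha}\alpha_\phi\frac{\phi'}{\phi}$; (D2) for every $a=\sum_\alpha a_\alpha\alpha\in\mathbb{K}$ the family $(\alpha')_{\alpha\in\mathrm{Supp}\,a}$ is summable and $a'=\sum_{\alpha\in\mathrm{Supp}\,a}a_\alpha\alpha'$. A derivation on $\mathbb{K}$ is of Hardy type if: (HD1) for all $a\in\mathbb{K}$, $a'=0\Leftrightarrow a\in\mathbb{R}$; (HD2) for all $a,b\in\mathbb{K}\setminus\{0\}$ with $a,b\not\asymp1$, $a\preccurlyeq b\Leftrightarrow a'\preccurlyeq b'$; (HD3) for all $a,b\in\mathbb{K}$ with $|a|\succ|b|\succ1$, $\frac{a'}{a}\succcurlyeq\frac{b'}{b}$, and moreover $\frac{a'}{a}\asymp\frac{b'}{b}$ iff $a$ and $b$ are comparable. For $\phi\in\Phi$, $\theta^{(\phi)}:=\mathrm{LM}(\phi'/\phi)\in\Gamma$. An element $a\in\mathbb{K}$ admits an integral $b$ if there is $b\in\mathbb{K}\setminus\{0\}$ with $b'=a$. *)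

theory Defs
  imports Complex_Main "HOL-Library.Option_ord"
begin

definition anti_well_ordered :: "'a::linorder set \<Rightarrow> bool" where
  "anti_well_ordered S \<longleftrightarrow> (\<forall>T\<subseteq>S. T \<noteq> {} \<longrightarrow> (\<exists>m\<in>T. \<forall>x\<in>T. x \<le> m))"

lemma anti_well_orderedD:
  assumes "anti_well_ordered S" "T \<subseteq> S" "T \<noteq> {}"
  obtains m where "m \<in> T" "\<And>x. x \<in> T \<Longrightarrow> x \<le> m"
proof -
  have "\<exists>m\<in>T. \<forall>x\<in>T. x \<le> m"
    using assms(1)[unfolded anti_well_ordered_def, rule_format, OF assms(2,3)] .
  then show ?thesis using that by blast
qed

lemma anti_well_ordered_subset: "anti_well_ordered S \<Longrightarrow> T \<subseteq> S \<Longrightarrow> anti_well_ordered T"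
  unfolding anti_well_ordered_def by (meson subset_trans)

lemma anti_well_ordered_no_chain:
  "anti_well_ordered S \<longleftrightarrow> \<not> (\<exists>s::nat \<Rightarrow> 'a::linorder. range s \<subseteq> S \<and> strict_mono s)"
proof
  assume S: "anti_well_ordered S"
  show "\<not> (\<exists>s::nat \<Rightarrow> 'a. range s \<subseteq> S \<and> strict_mono s)"
  proof
    assume "\<exists>s::nat \<Rightarrow> 'a. range s \<subseteq> S \<and> strict_mono s"
    then obtain s :: "nat \<Rightarrow> 'a" where s: "range s \<subseteq> S" "strict_mono s" by blast
    obtain m where m: "m \<in> range s" "\<And>x. x \<in> range s \<Longrightarrow> x \<le> m"
      using anti_well_orderedD[OF S s(1)] by blast
    then obtain n where "m = s n" by blast
    moreover have "s n < s (Suc n)" using s(2) by (simp add: strict_mono_less)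
    ultimately show False using m(2)[of "s (Suc n)"] by simp
  qed
next
  assume N: "\<not> (\<exists>s::nat \<Rightarrow> 'a. range s \<subseteq> S \<and> strict_mono s)"
  show "anti_well_ordered S"
    unfolding anti_well_ordered_def
  proof (intro allI impI, rule ccontr)
    fix T assume T: "T \<subseteq> S" "T \<noteq> {}" "\<not> (\<exists>m\<in>T. \<forall>x\<in>T. x \<le> m)"
    have "\<exists>s. \<forall>n. s n \<in> T \<and> s n < s (Suc n)"
      by (rule dependent_nat_choice) (use T in \<open>auto simp: not_le\<close>)
    then obtain s where "\<forall>n. s n \<in> T \<and> s n < s (Suc n)" by blast
    then have "range s \<subseteq> S" "strict_mono s"
      using T(1) by (auto simp: strict_mono_Suc_iff)
    then show False using N by blast
  qed
qed

lemma anti_well_ordered_Un: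
  assumes "anti_well_ordered S" "anti_well_ordered T"
  shows "anti_well_ordered (S \<union> T)"
  unfolding anti_well_ordered_def
proof (intro allI impI)
  fix U assume U: "U \<subseteq> S \<union> T" "U \<noteq> {}"
  show "\<exists>m\<in>U. \<forall>x\<in>U. x \<le> m"
  proof (cases "U \<inter> S = {} \<or> U \<inter> T = {}")
    case True
    then have "U \<subseteq> S \<or> U \<subseteq> T" using U by blast
    then show ?thesis using assms U(2) unfolding anti_well_ordered_def by blast
  next
    case False
    obtain m where m: "m \<in> U \<inter> S" "\<And>x. x \<in> U \<inter> S \<Longrightarrow> x \<le> m"
      using anti_well_orderedD[OF assms(1), of "U \<inter> S"] False by blast
    obtain n where n: "n \<in> U \<inter> T" "\<And>x. x \<in> U \<inter> T \<Longrightarrow> x \<le> n"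
      using anti_well_orderedD[OF assms(2), of "U \<inter> T"] False by blast
    have "max m n \<in> U" using m n by (auto simp: max_def)
    moreover have "\<forall>x\<in>U. x \<le> max m n" using m(2) n(2) U(1) by (auto simp: le_max_iff_disj)
    ultimately show ?thesis by blast
  qed
qed

lemma anti_well_ordered_finite: "finite S \<Longrightarrow> anti_well_ordered S"
  unfolding anti_well_ordered_def
proof (intro allI impI)
  fix T assume "finite S" "T \<subseteq> S" "T \<noteq> {}"
  then have "finite T" by (simp add: finite_subset)
  with \<open>T \<noteq> {}\<close> show "\<exists>m\<in>T. \<forall>x\<in>T. x \<le> m"
    by (intro bexI[of _ "Max T"]) auto
qed

lemma anti_well_ordered_decseq:
  fixes s :: "nat \<Rightarrow> 'a::linorder"
  assumes "anti_well_ordered S" "range s \<subseteq> S"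
  obtains f where "strict_mono f" "decseq (s \<circ> f)"
proof -
  obtain f where f: "strict_mono f" "monoseq (\<lambda>n. s (f n))"
    using seq_monosub by blast
  consider "decseq (s \<circ> f)" | "incseq (s \<circ> f)"
    using f(2) unfolding monoseq_iff by (auto simp: o_def)
  then show ?thesis
  proof cases
    case 1
    then show ?thesis using that f(1) by blast
  next
    case 2
    have "range (s \<circ> f) \<subseteq> S" using assms(2) by auto
    then obtain m where m: "m \<in> range (s \<circ> f)" "\<And>x. x \<in> range (s \<circ> f) \<Longrightarrow> x \<le> m"
      using anti_well_orderedD[OF assms(1), of "range (s \<circ> f)"] by blast
    then obtain N where N: "m = s (f N)" by auto
    have eq: "s (f n) = m" if "n \<ge> N" for n
      using that 2 m(2)[of "s (f n)"] N by (auto simp: incseq_def intro!: antisym)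
    have "strict_mono (f \<circ> (\<lambda>n. n + N))"
      using f(1) by (auto simp: strict_mono_def)
    moreover have "decseq (s \<circ> (f \<circ> (\<lambda>n. n + N)))"
      using eq by (auto simp: decseq_def)
    ultimately show ?thesis using that by blast
  qed
qed

lemma anti_well_ordered_plus:
  fixes S T :: "'a::linordered_ab_group_add set"
  assumes "anti_well_ordered S" "anti_well_ordered T"
  shows "anti_well_ordered {x + y |x y. x \<in> S \<and> y \<in> T}"
  unfolding anti_well_ordered_no_chain
proof
  assume "\<exists>s::nat \<Rightarrow> 'a. range s \<subseteq> {x + y |x y. x \<in> S \<and> y \<in> T} \<and> strict_mono s"
  then obtain s :: "nat \<Rightarrow> 'a"
    where s: "range s \<subseteq> {x + y |x y. x \<in> S \<and> y \<in> T}" "strict_mono s" by blast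
  have "\<forall>n. \<exists>x. x \<in> S \<and> s n - x \<in> T"
  proof
    fix n
    have "s n \<in> {x + y |x y. x \<in> S \<and> y \<in> T}" using s(1) by blast
    then show "\<exists>x. x \<in> S \<and> s n - x \<in> T" by auto
  qed
  then obtain x where x: "\<And>n. x n \<in> S" "\<And>n. s n - x n \<in> T" by metis
  obtain f where f: "strict_mono f" "decseq (x \<circ> f)"
    using anti_well_ordered_decseq[OF assms(1), of x] x(1) by blast
  define t where "t n = s (f n) - x (f n)" for n
  have "strict_mono t"
    unfolding strict_mono_def
  proof (intro allI impI)
    fix m n :: nat assume mn: "m < n"
    have "s (f m) < s (f n)" using mn f(1) s(2) by (simp add: strict_mono_less)
    moreover have "x (f n) \<le> x (f m)" using f(2) mn by (auto simp: decseq_def)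
    ultimately show "t m < t n"
      unfolding t_def by (metis diff_strict_right_mono diff_left_mono order_less_le_trans)
  qed
  moreover have "range t \<subseteq> T" using x(2) by (auto simp: t_def)
  ultimately show False using assms(2) unfolding anti_well_ordered_no_chain by blast
qed

lemma anti_well_ordered_convolution_finite:
  fixes S T :: "'a::linordered_ab_group_add set"
  assumes "anti_well_ordered S" "anti_well_ordered T"
  shows "finite {x \<in> S. z - x \<in> T}"
proof (rule ccontr)
  assume "infinite {x \<in> S. z - x \<in> T}"
  then obtain s :: "nat \<Rightarrow> 'a" where s: "inj s" "range s \<subseteq> {x \<in> S. z - x \<in> T}"
    using infinite_countable_subset by blast
  then obtain f where f: "strict_mono f" "decseq (s \<circ> f)"
    using anti_well_ordered_decseq[OF assms(1), of s] by blast
  have "strict_mono (\<lambda>n. z - s (f n))"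
    unfolding strict_mono_def
  proof (intro allI impI)
    fix m n :: nat assume mn: "m < n"
    have "s (f m) \<noteq> s (f n)"
      using mn f(1) s(1) by (metis injD nat_less_le strict_mono_eq)
    moreover have "s (f n) \<le> s (f m)" using f(2) mn by (auto simp: decseq_def)
    ultimately show "z - s (f m) < z - s (f n)" by simp
  qed
  moreover have "range (\<lambda>n. z - s (f n)) \<subseteq> T" using s(2) by auto
  ultimately show False using assms(2) unfolding anti_well_ordered_no_chain by blast
qed

text \<open>Formal sums with anti-well-ordered support. The same construction is used twice: for totally
  ordered \<open>'p\<close>, the type \<open>'p hahn\<close> is the Hahn group \<open>\<^bold>H\<close> over \<open>'p\<close>, written additively (the
  coefficients are the exponents, so the monomial \<open>1\<close> is \<open>0\<close>, products of monomials are sums, and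
  \<open>\<gamma> \<succ> 1\<close> is \<open>0 < \<gamma>\<close>); for an ordered abelian group \<open>'g\<close>, the type \<open>'g hahn\<close> is the
  field of generalised series \<open>\<real>((g))\<close>.\<close>

typedef (overloaded) 'a hahn = "{f :: 'a::linorder \<Rightarrow> real. anti_well_ordered {x. f x \<noteq> 0}}"
  morphisms coeff Abs_hahn
  by (rule exI[of _ "\<lambda>_. 0"]) (simp add: anti_well_ordered_def)

setup_lifting type_definition_hahn

definition supp :: "'a::linorder hahn \<Rightarrow> 'a set" where
  "supp a = {x. coeff a x \<noteq> 0}"

definition lead :: "'a::linorder hahn \<Rightarrow> 'a" where
  "lead a = (GREATEST x. x \<in> supp a)"

lemma supp_anti_well_ordered: "anti_well_ordered (supp a)"
  using coeff[of a] by (simp add: supp_def)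

lemma hahn_eqI: "(\<And>x. coeff a x = coeff b x) \<Longrightarrow> a = b"
  by (metis coeff_inject ext)

lemma coeff_Abs_hahn: "anti_well_ordered {x. f x \<noteq> 0} \<Longrightarrow> coeff (Abs_hahn f) x = f x"
  by (subst Abs_hahn_inverse) simp_all

lift_definition single :: "'a::linorder \<Rightarrow> real \<Rightarrow> 'a hahn" is "\<lambda>x r y. if y = x then r else 0"
  by (rule anti_well_ordered_finite) simp

instantiation hahn :: (linorder) real_vector
begin

lift_definition zero_hahn :: "'a hahn" is "\<lambda>_. 0"
  by (simp add: anti_well_ordered_def)

lift_definition plus_hahn :: "'a hahn \<Rightarrow> 'a hahn \<Rightarrow> 'a hahn" is "\<lambda>f g x. f x + g x"
  by (rule anti_well_ordered_subset, erule (1) anti_well_ordered_Un) auto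

lift_definition minus_hahn :: "'a hahn \<Rightarrow> 'a hahn \<Rightarrow> 'a hahn" is "\<lambda>f g x. f x - g x"
  by (rule anti_well_ordered_subset, erule (1) anti_well_ordered_Un) auto

lift_definition uminus_hahn :: "'a hahn \<Rightarrow> 'a hahn" is "\<lambda>f x. - f x"
  by simp

lift_definition scaleR_hahn :: "real \<Rightarrow> 'a hahn \<Rightarrow> 'a hahn" is "\<lambda>r f x. r * f x"
  by (erule anti_well_ordered_subset) auto

instance
  by standard (transfer; simp add: algebra_simps fun_eq_iff)+

end

lemma coeff_simps [simp]:
  "coeff 0 x = 0" "coeff (a + b) x = coeff a x + coeff b x"
  "coeff (a - b) x = coeff a x - coeff b x" "coeff (- a) x = - coeff a x"
  "coeff (r *\<^sub>R a) x = r * coeff a x"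
  "coeff (single y r) x = (if x = y then r else 0)"
  by (transfer; simp)+

lemma supp_eq_empty_iff [simp]: "supp a = {} \<longleftrightarrow> a = 0"
  by (auto simp: supp_def intro: hahn_eqI)

lemma in_supp_iff: "x \<in> supp a \<longleftrightarrow> coeff a x \<noteq> 0"
  by (simp add: supp_def)

lemma supp_single [simp]: "r \<noteq> 0 \<Longrightarrow> supp (single x r) = {x}"
  by (auto simp: supp_def)

lemma leadI:
  assumes "coeff a x \<noteq> 0" "\<And>y. x < y \<Longrightarrow> coeff a y = 0"
  shows "lead a = x"
  unfolding lead_def
  by (rule Greatest_equality) (use assms in \<open>auto simp: in_supp_iff not_less[symmetric]\<close>)

lemma
  assumes "a \<noteq> 0"
  shows coeff_lead: "coeff a (lead a) \<noteq> 0" and coeff_above_lead: "lead a < y \<Longrightarrow> coeff a y = 0"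
proof -
  obtain m where m: "m \<in> supp a" "\<And>x. x \<in> supp a \<Longrightarrow> x \<le> m"
    using anti_well_orderedD[OF supp_anti_well_ordered[of a], of "supp a"] assms by auto
  have "lead a = m"
    using m by (intro leadI) (auto simp: in_supp_iff not_le[symmetric])
  with m show "coeff a (lead a) \<noteq> 0" "lead a < y \<Longrightarrow> coeff a y = 0"
    by (auto simp: in_supp_iff not_le[symmetric])
qed

lemma lead_single [simp]: "r \<noteq> 0 \<Longrightarrow> lead (single x r) = x"
  by (rule leadI) auto

definition lpos :: "'a::linorder hahn \<Rightarrow> bool" where
  "lpos a \<longleftrightarrow> a \<noteq> 0 \<and> 0 < coeff a (lead a)"

lemma lpos_iff: "lpos a \<longleftrightarrow> (\<exists>x. 0 < coeff a x \<and> (\<forall>y>x. coeff a y = 0))"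
proof
  show "lpos a \<Longrightarrow> \<exists>x. 0 < coeff a x \<and> (\<forall>y>x. coeff a y = 0)"
    unfolding lpos_def using coeff_above_lead by blast
next
  assume "\<exists>x. 0 < coeff a x \<and> (\<forall>y>x. coeff a y = 0)"
  then obtain x where x: "0 < coeff a x" "\<And>y. x < y \<Longrightarrow> coeff a y = 0" by blast
  then have "lead a = x" by (intro leadI) auto
  with x show "lpos a" by (auto simp: lpos_def)
qed

lemma lpos_add: "lpos a \<Longrightarrow> lpos b \<Longrightarrow> lpos (a + b)"
proof -
  assume "lpos a" "lpos b"
  then obtain x y where x: "0 < coeff a x" "\<forall>z>x. coeff a z = 0"
    and y: "0 < coeff b y" "\<forall>z>y. coeff b z = 0" unfolding lpos_iff by blast
  have "0 < coeff (a + b) (max x y)"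
    using x y by (cases x y rule: linorder_cases) (auto simp: max_def)
  then show ?thesis unfolding lpos_iff using x y by (intro exI[of _ "max x y"]) auto
qed

lemma lpos_cases: "a = 0 \<or> lpos a \<or> lpos (- a)"
proof (cases "a = 0")
  case False
  then have "lead (- a) = lead a"
    by (intro leadI) (auto simp: coeff_lead coeff_above_lead)
  then show ?thesis using False coeff_lead[OF False] by (auto simp: lpos_def)
qed simp

lemma not_lpos_uminus: "lpos a \<Longrightarrow> \<not> lpos (- a)"
  using lpos_add[of a "- a"] by (auto simp: lpos_def)

instantiation hahn :: (linorder) linordered_ab_group_add
begin

definition less_hahn :: "'a hahn \<Rightarrow> 'a hahn \<Rightarrow> bool" where
  "a < b \<longleftrightarrow> a \<noteq> b \<and> 0 < coeff (b - a) (lead (b - a))"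

definition less_eq_hahn :: "'a hahn \<Rightarrow> 'a hahn \<Rightarrow> bool" where
  "(a::'a hahn) \<le> b \<longleftrightarrow> a = b \<or> a < b"

lemma less_hahn_lpos: "(a::'a hahn) < b \<longleftrightarrow> lpos (b - a)"
  by (auto simp: less_hahn_def lpos_def)

instance
proof
  fix a b c :: "'a hahn"
  have asym: "\<not> b < a" if "a < b" for a b :: "'a hahn"
    using that not_lpos_uminus[of "b - a"] by (simp add: less_hahn_lpos)
  have trans: "a < c" if "a < b" "b < c" for a b c :: "'a hahn"
    using that lpos_add[of "b - a" "c - b"] by (simp add: less_hahn_lpos)
  show "a < b \<longleftrightarrow> a \<le> b \<and> \<not> b \<le> a"
    using asym[of a b] asym[of a a] by (auto simp: less_eq_hahn_def)
  show "a \<le> a" by (simp add: less_eq_hahn_def)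
  show "a \<le> b \<Longrightarrow> b \<le> c \<Longrightarrow> a \<le> c"
    using trans by (auto simp: less_eq_hahn_def)
  show "a \<le> b \<Longrightarrow> b \<le> a \<Longrightarrow> a = b"
    using asym by (auto simp: less_eq_hahn_def)
  show "a \<le> b \<Longrightarrow> c + a \<le> c + b"
    by (auto simp: less_eq_hahn_def less_hahn_lpos)
  show "a \<le> b \<or> b \<le> a"
    using lpos_cases[of "b - a"] by (auto simp: less_eq_hahn_def less_hahn_lpos)
qed

end

lemma hahn_pos_iff: "0 < a \<longleftrightarrow> a \<noteq> 0 \<and> 0 < coeff a (lead a)"
  by (simp add: less_hahn_lpos lpos_def)

definition hprod :: "'a::linordered_ab_group_add hahn \<Rightarrow> 'a hahn \<Rightarrow> 'a \<Rightarrow> real" where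
  "hprod a b z = (\<Sum>x\<in>{x \<in> supp a. z - x \<in> supp b}. coeff a x * coeff b (z - x))"

lemma hprod_support: "hprod a b z \<noteq> 0 \<Longrightarrow> \<exists>x y. z = x + y \<and> x \<in> supp a \<and> y \<in> supp b"
proof -
  assume "hprod a b z \<noteq> 0"
  then have "{x \<in> supp a. z - x \<in> supp b} \<noteq> {}" unfolding hprod_def by force
  then obtain x where "x \<in> supp a" "z - x \<in> supp b" by blast
  then show ?thesis by (intro exI[of _ x] exI[of _ "z - x"]) simp
qed

instantiation hahn :: (linordered_ab_group_add) "{one, times}"
begin

definition one_hahn :: "'a hahn" where "1 = single 0 1"

definition times_hahn :: "'a hahn \<Rightarrow> 'a hahn \<Rightarrow> 'a hahn" where
  "a * b = Abs_hahn (\<lambda>z. \<Sum>x\<in>{x \<in> supp a. z - x \<in> supp b}. coeff a x * coeff b (z - x))"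

instance ..

end

lemma coeff_times:
  "coeff (a * b) z = (\<Sum>x\<in>{x \<in> supp a. z - x \<in> supp b}. coeff a x * coeff b (z - x))"
proof -
  have "anti_well_ordered {z. hprod a b z \<noteq> 0}"
    by (rule anti_well_ordered_subset
        [OF anti_well_ordered_plus[OF supp_anti_well_ordered[of a] supp_anti_well_ordered[of b]]])
      (use hprod_support in blast)
  then show ?thesis
    unfolding times_hahn_def hprod_def by (rule coeff_Abs_hahn)
qed

lemma supp_times: "supp (a * b) \<subseteq> {x + y |x y. x \<in> supp a \<and> y \<in> supp b}"
  using hprod_support[of a b] by (auto simp: in_supp_iff coeff_times hprod_def)

lemma coeff_times_superset:
  assumes "finite X" "{x \<in> supp a. z - x \<in> supp b} \<subseteq> X"
  shows "coeff (a * b) z = (\<Sum>x\<in>X. coeff a x * coeff b (z - x))"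
  unfolding coeff_times
  by (rule sum.mono_neutral_left) (use assms in \<open>auto simp: in_supp_iff\<close>)

lemma coeff_times_shift:
  assumes "finite U" "{u. u - x \<in> supp a \<and> z + x - u \<in> supp b} \<subseteq> U"
  shows "coeff (a * b) z = (\<Sum>u\<in>U. coeff a (u - x) * coeff b (z + x - u))"
proof -
  have "coeff (a * b) z = (\<Sum>y\<in>(\<lambda>u. u - x) ` U. coeff a y * coeff b (z - y))"
  proof (rule coeff_times_superset)
    show "{y \<in> supp a. z - y \<in> supp b} \<subseteq> (\<lambda>u. u - x) ` U"
    proof
      fix y assume "y \<in> {y \<in> supp a. z - y \<in> supp b}"
      then have "y + x \<in> U" using assms(2) by (auto simp: algebra_simps)
      then show "y \<in> (\<lambda>u. u - x) ` U" by (intro image_eqI[of _ _ "y + x"]) auto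
    qed
  qed (use assms in simp)
  also have "\<dots> = (\<Sum>u\<in>U. coeff a (u - x) * coeff b (z - (u - x)))"
    by (subst sum.reindex) (auto simp: inj_on_def)
  finally show ?thesis by (simp add: algebra_simps)
qed

lemma hahn_mult_assoc: "(a * b) * c = a * (b * c)" for a b c :: "'a::linordered_ab_group_add hahn"
proof (rule hahn_eqI)
  fix z
  define X where "X = {x \<in> supp a. z - x \<in> {y + w |y w. y \<in> supp b \<and> w \<in> supp c}}"
  define U where "U = {u \<in> {x + y |x y. x \<in> supp a \<and> y \<in> supp b}. z - u \<in> supp c}"
  have X: "finite X" unfolding X_def
    by (intro anti_well_ordered_convolution_finite anti_well_ordered_plus supp_anti_well_ordered)
  have U: "finite U" unfolding U_def
    by (intro anti_well_ordered_convolution_finite anti_well_ordered_plus supp_anti_well_ordered)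
  have ab: "coeff (a * b) u * coeff c (z - u) = (\<Sum>x\<in>X. coeff a x * coeff b (u - x)) * coeff c (z - u)"
    for u
  proof (cases "z - u \<in> supp c")
    case True
    have "{x \<in> supp a. u - x \<in> supp b} \<subseteq> X"
    proof
      fix x assume "x \<in> {x \<in> supp a. u - x \<in> supp b}"
      moreover have "z - x = (u - x) + (z - u)" by simp
      ultimately show "x \<in> X" using True unfolding X_def by blast
    qed
    then show ?thesis using coeff_times_superset[OF X, of a u b] by simp
  qed (simp add: in_supp_iff)
  have bc: "coeff a x * coeff (b * c) (z - x)
      = coeff a x * (\<Sum>u\<in>U. coeff b (u - x) * coeff c (z - u))" for x
  proof (cases "x \<in> supp a")
    case True
    have "{u. u - x \<in> supp b \<and> z - x + x - u \<in> supp c} \<subseteq> U"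
    proof
      fix u assume "u \<in> {u. u - x \<in> supp b \<and> z - x + x - u \<in> supp c}"
      then have "u = x + (u - x)" "u - x \<in> supp b" "z - u \<in> supp c" by simp_all
      then show "u \<in> U" using True unfolding U_def by blast
    qed
    then show ?thesis using coeff_times_shift[OF U, of x b "z - x" c] by simp
  qed (simp add: in_supp_iff)
  have "coeff (a * b * c) z = (\<Sum>u\<in>U. coeff (a * b) u * coeff c (z - u))"
    by (rule coeff_times_superset[OF U]) (use supp_times in \<open>fastforce simp: U_def\<close>)
  also have "\<dots> = (\<Sum>u\<in>U. \<Sum>x\<in>X. coeff a x * coeff b (u - x) * coeff c (z - u))"
    by (simp only: ab sum_distrib_right)
  also have "\<dots> = (\<Sum>x\<in>X. \<Sum>u\<in>U. coeff a x * coeff b (u - x) * coeff c (z - u))"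
    by (rule sum.swap)
  also have "\<dots> = (\<Sum>x\<in>X. coeff a x * coeff (b * c) (z - x))"
    by (simp only: bc sum_distrib_left mult.assoc)
  also have "\<dots> = coeff (a * (b * c)) z"
    by (rule coeff_times_superset[OF X, symmetric]) (use supp_times in \<open>fastforce simp: X_def\<close>)
  finally show "coeff (a * b * c) z = coeff (a * (b * c)) z" .
qed

lemma hahn_mult_commute: "a * b = b * a" for a b :: "'a::linordered_ab_group_add hahn"
proof (rule hahn_eqI)
  fix z
  show "coeff (a * b) z = coeff (b * a) z"
    unfolding coeff_times
    by (rule sum.reindex_bij_witness[of _ "\<lambda>x. z - x" "\<lambda>x. z - x"]) auto
qed

lemma hahn_distrib_right: "(a + b) * c = a * c + b * c" for a b c :: "'a::linordered_ab_group_add hahn"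
proof (rule hahn_eqI)
  fix z
  define X where "X = {x \<in> supp a \<union> supp b. z - x \<in> supp c}"
  have X: "finite X" unfolding X_def
    by (intro anti_well_ordered_convolution_finite anti_well_ordered_Un supp_anti_well_ordered)
  have "coeff (a * c) z = (\<Sum>x\<in>X. coeff a x * coeff c (z - x))"
    "coeff (b * c) z = (\<Sum>x\<in>X. coeff b x * coeff c (z - x))"
    "coeff ((a + b) * c) z = (\<Sum>x\<in>X. coeff (a + b) x * coeff c (z - x))"
    by (rule coeff_times_superset[OF X], force simp: X_def in_supp_iff)+
  then show "coeff ((a + b) * c) z = coeff (a * c + b * c) z"
    by (simp add: algebra_simps sum.distrib)
qed

lemma coeff_single_times: "coeff (single x r * a) z = r * coeff a (z - x)"
  by (subst coeff_times_superset[of "{x}"]) (auto simp: in_supp_iff split: if_splits)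

lemma scaleR_hahn_eq: "r *\<^sub>R a = single 0 r * (a :: 'a::linordered_ab_group_add hahn)"
  by (rule hahn_eqI) (simp add: coeff_single_times)

lemma coeff_one: "coeff 1 x = (if x = 0 then 1 else 0)"
  by (simp add: one_hahn_def)

instance hahn :: (linordered_ab_group_add) comm_ring_1
proof
  fix a b c :: "'a hahn"
  show "a * b * c = a * (b * c)" by (rule hahn_mult_assoc)
  show "a * b = b * a" by (rule hahn_mult_commute)
  show "(a + b) * c = a * c + b * c" by (rule hahn_distrib_right)
  show "1 * a = a" unfolding one_hahn_def by (rule hahn_eqI) (simp add: coeff_single_times)
  show "(0::'a hahn) \<noteq> 1" by (metis coeff_one coeff_simps(1) zero_neq_one)
qed

instance hahn :: (linordered_ab_group_add) real_algebra_1
  by standard (simp_all add: scaleR_hahn_eq ac_simps)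

lemma of_real_hahn: "of_real r = single 0 r"
  by (rule hahn_eqI) (simp add: of_real_def coeff_one)

lemma single_times_single: "single x r * single y s = single (x + y) (r * s)"
  by (rule hahn_eqI) (auto simp: coeff_single_times algebra_simps)

lemma coeff_times_lead:
  fixes a b :: "'a::linordered_ab_group_add hahn"
  assumes "a \<noteq> 0" "b \<noteq> 0"
  shows "coeff (a * b) (lead a + lead b) = coeff a (lead a) * coeff b (lead b)"
    and "lead a + lead b < z \<Longrightarrow> coeff (a * b) z = 0"
    and "lead (a * b) = lead a + lead b"
proof -
  have le: "x \<le> lead a" if "x \<in> supp a" for x
    using that coeff_above_lead[OF assms(1)] by (force simp: in_supp_iff)
  have le': "x \<le> lead b" if "x \<in> supp b" for x
    using that coeff_above_lead[OF assms(2)] by (force simp: in_supp_iff)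
  have "x = lead a" if "x \<in> supp a" "lead a + lead b - x \<in> supp b" for x
    using le[OF that(1)] le'[OF that(2)] by (simp add: algebra_simps)
  then show 1: "coeff (a * b) (lead a + lead b) = coeff a (lead a) * coeff b (lead b)"
    by (subst coeff_times_superset[of "{lead a}"]) auto
  show 2: "coeff (a * b) z = 0" if "lead a + lead b < z" for z
  proof (rule ccontr)
    assume "coeff (a * b) z \<noteq> 0"
    then obtain x y where "x \<in> supp a" "y \<in> supp b" "z = x + y"
      using supp_times[of a b] by (auto simp: in_supp_iff)
    then show False using le le' that by (meson add_mono not_le)
  qed
  show "lead (a * b) = lead a + lead b"
    by (rule leadI) (use 1 2 coeff_lead assms in auto)
qed

instance hahn :: (linordered_ab_group_add) idom
proof
  fix a b :: "'a hahn"
  assume ab: "a \<noteq> 0" "b \<noteq> 0"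
  then have "coeff (a * b) (lead a + lead b) \<noteq> 0"
    by (simp add: coeff_times_lead coeff_lead)
  then show "a * b \<noteq> 0" by auto
qed

definition trunc :: "'a::linorder hahn \<Rightarrow> 'a \<Rightarrow> 'a hahn" where
  "trunc a x = Abs_hahn (\<lambda>y. if x < y then coeff a y else 0)"

lemma coeff_trunc: "coeff (trunc a x) y = (if x < y then coeff a y else 0)"
proof -
  have "anti_well_ordered {y. (if x < y then coeff a y else 0) \<noteq> 0}"
    by (rule anti_well_ordered_subset[OF supp_anti_well_ordered[of a]]) (auto simp: in_supp_iff)
  then show ?thesis unfolding trunc_def by (rule coeff_Abs_hahn)
qed

text \<open>Transfinite successive approximation: an additive map that acts on leading terms by a strictly
  increasing \<open>h\<close> attains \<open>c\<close>, provided every nonzero remainder has its leading exponent in the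
  range of \<open>h\<close>.\<close>

lemma successive_approximation:
  fixes D :: "'a::linorder hahn \<Rightarrow> 'b::linorder hahn" and h :: "'a \<Rightarrow> 'b" and k :: "'a \<Rightarrow> real"
  assumes add: "\<And>a b. supp a \<subseteq> M \<Longrightarrow> supp b \<subseteq> M \<Longrightarrow> D (a + b) = D a + D b"
    and h: "strict_mono_on M h"
    and k: "\<And>x. x \<in> M \<Longrightarrow> k x \<noteq> 0"
    and lt: "\<And>b. supp b \<subseteq> M \<Longrightarrow> b \<noteq> 0 \<Longrightarrow> coeff (D b) (h (lead b)) = k (lead b) * coeff b (lead b)"
    and above: "\<And>b y. supp b \<subseteq> M \<Longrightarrow> b \<noteq> 0 \<Longrightarrow> h (lead b) < y \<Longrightarrow> coeff (D b) y = 0"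
    and rem: "\<And>b. supp b \<subseteq> M \<Longrightarrow> D b \<noteq> c \<Longrightarrow> lead (c - D b) \<in> h ` M"
  shows "\<exists>b. supp b \<subseteq> M \<and> D b = c"
proof -
  define good where "good b \<longleftrightarrow> supp b \<subseteq> M \<and> (\<forall>x\<in>supp b. D (trunc b x) \<noteq> c \<and>
      lead (c - D (trunc b x)) = h x \<and> coeff (c - D (trunc b x)) (h x) = k x * coeff b x)" for b
  have goodD: "supp b \<subseteq> M" "x \<in> supp b \<Longrightarrow> D (trunc b x) \<noteq> c"
    "x \<in> supp b \<Longrightarrow> lead (c - D (trunc b x)) = h x"
    "x \<in> supp b \<Longrightarrow> coeff (c - D (trunc b x)) (h x) = k x * coeff b x" if "good b" for b x
    using that unfolding good_def by auto
  have inj: "x = y" if "h x = h y" "x \<in> M" "y \<in> M" for x y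
    using h that by (metis inj_onD strict_mono_on_imp_inj_on)
  have init: "b' = trunc b x" if gb: "good b" "good b'" and x: "x = lead (b - b')" "b \<noteq> b'"
    and xb: "x \<in> supp b" for b b' x
  proof -
    have nz: "b - b' \<noteq> 0" using x by simp
    have ag: "coeff b y = coeff b' y" if "x < y" for y
      using coeff_above_lead[OF nz] that x by force
    have neq: "coeff b x \<noteq> coeff b' x"
      using coeff_lead[OF nz] x by simp
    have tr: "trunc b x = trunc b' x"
      by (rule hahn_eqI) (simp add: coeff_trunc ag)
    have notin: "x \<notin> supp b'"
    proof
      assume xb': "x \<in> supp b'"
      have "k x * coeff b x = k x * coeff b' x"
        using goodD(4)[OF gb(1) xb] goodD(4)[OF gb(2) xb'] tr by simp
      then show False using neq k goodD(1)[OF gb(1)] xb by auto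
    qed
    have low: "coeff b' y = 0" if "y < x" for y
    proof (rule ccontr)
      assume "coeff b' y \<noteq> 0"
      then have "{z \<in> supp b'. z < x} \<noteq> {}" using that by (auto simp: in_supp_iff)
      then obtain m where m: "m \<in> {z \<in> supp b'. z < x}" "\<And>z. z \<in> {z \<in> supp b'. z < x} \<Longrightarrow> z \<le> m"
        using anti_well_orderedD[OF supp_anti_well_ordered[of b'], of "{z \<in> supp b'. z < x}"]
        by blast
      have "trunc b' m = trunc b' x"
      proof (rule hahn_eqI)
        fix z
        have "coeff b' z = 0" if "m < z" "\<not> x < z"
        proof (cases "z = x")
          case True
          then show ?thesis using notin by (simp add: in_supp_iff)
        next
          case False
          then show ?thesis using m(2)[of z] that by (force simp: in_supp_iff)
        qed
        then show "coeff (trunc b' m) z = coeff (trunc b' x) z"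
          using m(1) by (auto simp: coeff_trunc)
      qed
      then have "h m = h x"
        using goodD(3)[OF gb(2), of m] goodD(3)[OF gb(1) xb] m(1) tr by simp
      then have "m = x"
        by (rule inj) (use goodD(1)[OF gb(1)] goodD(1)[OF gb(2)] xb m(1) in auto)
      then show False using m(1) by simp
    qed
    show "b' = trunc b x"
    proof (rule hahn_eqI)
      fix y
      show "coeff b' y = coeff (trunc b x) y"
        using low[of y] ag[of y] notin
        by (cases y x rule: linorder_cases) (auto simp: coeff_trunc in_supp_iff)
    qed
  qed
  \<comment> \<open>any two good series are comparable for truncation\<close>
  have cmp: "b = b' \<or> (\<exists>x\<in>supp b. b' = trunc b x) \<or> (\<exists>x\<in>supp b'. b = trunc b' x)"
    if "good b" "good b'" for b b'
  proof (cases "b = b'")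
    case False
    define x where "x = lead (b - b')"
    have nz: "b - b' \<noteq> 0" "b' - b \<noteq> 0" using False by auto
    have x': "x = lead (b' - b)"
      unfolding x_def
    proof (rule leadI)
      show "coeff (b - b') (lead (b' - b)) \<noteq> 0" using coeff_lead[OF nz(2)] by simp
      show "coeff (b - b') y = 0" if "lead (b' - b) < y" for y
        using coeff_above_lead[OF nz(2) that] by simp
    qed
    have "x \<in> supp b \<or> x \<in> supp b'"
      using coeff_lead[OF nz(1)] unfolding x_def by (auto simp: in_supp_iff)
    then show ?thesis
      using init[OF that x_def False] init[OF that(2,1) x' False[symmetric]] by blast
  qed simp
  have up: "y \<in> supp b \<and> coeff b y = coeff b' y"
    if gb: "good b" "good b'" and xy: "x \<in> supp b" "y \<in> supp b'" "x \<le> y" for b b' x y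
  proof -
    consider "b = b'" | z where "z \<in> supp b" "b' = trunc b z" | z where "z \<in> supp b'" "b = trunc b' z"
      using cmp[OF gb] by blast
    then show ?thesis
      by cases (use xy in \<open>auto simp: coeff_trunc in_supp_iff split: if_splits\<close>)
  qed
  have same: "coeff b y = coeff b' y" if "good b" "good b'" "y \<in> supp b" "y \<in> supp b'" for b b' y
    using up[OF that] by simp
  define S where "S = (\<Union>b\<in>Collect good. supp b)"
  define f where "f y = (if y \<in> S then coeff (SOME b. good b \<and> y \<in> supp b) y else 0)" for y
  have f: "f y = coeff b y" if "good b" "y \<in> supp b" for b y
  proof -
    have "good (SOME b. good b \<and> y \<in> supp b) \<and> y \<in> supp (SOME b. good b \<and> y \<in> supp b)"
      by (rule someI[of _ b]) (use that in simp)
    moreover have "y \<in> S" using that by (auto simp: S_def)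
    ultimately show ?thesis
      using same[of "SOME b. good b \<and> y \<in> supp b" b y] that by (simp add: f_def)
  qed
  have "anti_well_ordered {y. f y \<noteq> 0}"
    unfolding anti_well_ordered_def
  proof (intro allI impI)
    fix T assume T: "T \<subseteq> {y. f y \<noteq> 0}" "T \<noteq> {}"
    then have TS: "T \<subseteq> S" by (auto simp: f_def split: if_splits)
    obtain t where tT: "t \<in> T" using T(2) by blast
    then obtain b where t: "t \<in> T" "good b" "t \<in> supp b" using TS by (auto simp: S_def)
    obtain m where m: "m \<in> T \<inter> supp b" "\<And>y. y \<in> T \<inter> supp b \<Longrightarrow> y \<le> m"
      using anti_well_orderedD[OF supp_anti_well_ordered[of b], of "T \<inter> supp b"] t by blast
    have "y \<le> m" if "y \<in> T" for y
    proof (rule ccontr)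
      assume "\<not> y \<le> m"
      moreover have "y \<in> S" using TS that by blast
      then obtain b' where "good b'" "y \<in> supp b'" unfolding S_def by blast
      ultimately have "y \<in> supp b" using up[OF t(2), of b' m y] m(1) by auto
      then show False using m(2) that \<open>\<not> y \<le> m\<close> by blast
    qed
    then show "\<exists>m\<in>T. \<forall>x\<in>T. x \<le> m" using m(1) by blast
  qed
  then have B_ex: "coeff (Abs_hahn f) y = f y" for y by (rule coeff_Abs_hahn)
  define B where "B = Abs_hahn f"
  have B: "coeff B y = f y" for y using B_ex by (simp add: B_def)
  have suppB: "supp B = S"
  proof (rule set_eqI)
    fix y
    show "y \<in> supp B \<longleftrightarrow> y \<in> S"
    proof (cases "y \<in> S")
      case True
      then obtain b where "good b" "y \<in> supp b" unfolding S_def by blast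
      then show ?thesis using True f[of b y] by (simp add: in_supp_iff B)
    next
      case False
      then show ?thesis by (simp add: in_supp_iff B f_def)
    qed
  qed
  have truncB: "trunc B x = trunc b x" if "good b" "x \<in> supp b" for b x
  proof (rule hahn_eqI)
    fix y
    have "coeff B y = coeff b y" if xy: "x < y"
    proof (cases "y \<in> S")
      case True
      then obtain b' where "good b'" "y \<in> supp b'" by (auto simp: S_def)
      then show ?thesis
        using up[OF \<open>good b\<close> _ \<open>x \<in> supp b\<close>, of b' y] xy f[of b' y] B by auto
    next
      case False
      then have "y \<notin> supp b" using \<open>good b\<close> by (auto simp: S_def)
      then show ?thesis using False suppB by (auto simp: in_supp_iff)
    qed
    then show "coeff (trunc B x) y = coeff (trunc b x) y" by (simp add: coeff_trunc)
  qed
  have goodB: "good B"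
    unfolding good_def
  proof (intro conjI ballI)
    show "supp B \<subseteq> M" using goodD(1) by (auto simp: suppB S_def)
    fix x assume "x \<in> supp B"
    then obtain b where b: "good b" "x \<in> supp b" by (auto simp: suppB S_def)
    then show "D (trunc B x) \<noteq> c" "lead (c - D (trunc B x)) = h x"
      "coeff (c - D (trunc B x)) (h x) = k x * coeff B x"
      using truncB[OF b] goodD[OF b(1)] f[OF b] B by auto
  qed
  have "D B = c"
  proof (rule ccontr)
    assume DB: "D B \<noteq> c"
    then have nz: "c - D B \<noteq> 0" by simp
    have BM: "supp B \<subseteq> M" using goodD(1)[OF goodB] .
    obtain \<mu> where \<mu>: "\<mu> \<in> M" "lead (c - D B) = h \<mu>" using rem[OF BM DB] by blast
    have less: "\<mu> < x" if x: "x \<in> supp B" for x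
    proof -
      let ?t = "trunc B x"
      have st: "supp ?t \<subseteq> M" "supp (B - ?t) \<subseteq> M"
        using BM by (auto simp: in_supp_iff coeff_trunc subset_iff split: if_splits)
      have lx: "lead (B - ?t) = x"
        by (rule leadI) (use x in \<open>auto simp: coeff_trunc in_supp_iff\<close>)
      have cx: "coeff (B - ?t) x = coeff B x" by (simp add: coeff_trunc)
      have n0: "B - ?t \<noteq> 0" using cx x by (auto simp: in_supp_iff)
      have eq: "c - D B = (c - D ?t) - D (B - ?t)"
        using add[OF st] by simp
      have "coeff (c - D B) (h x) = 0"
        unfolding eq using lt[OF st(2) n0] goodD(4)[OF goodB x] lx cx by simp
      moreover have "coeff (c - D B) y = 0" if "h x < y" for y
      proof -
        have "c - D ?t \<noteq> 0" using goodD(2)[OF goodB x] by simp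
        then have "coeff (c - D ?t) y = 0"
          using coeff_above_lead goodD(3)[OF goodB x] that by metis
        moreover have "coeff (D (B - ?t)) y = 0" using above[OF st(2) n0] lx that by simp
        ultimately show ?thesis unfolding eq by simp
      qed
      ultimately have "h \<mu> < h x"
        using coeff_lead[OF nz] \<mu>(2) by (metis linorder_neqE)
      then show "\<mu> < x"
        using h \<mu>(1) BM x by (metis strict_mono_on_less subsetD)
    qed
    define r where "r = coeff (c - D B) (h \<mu>) / k \<mu>"
    have r: "r \<noteq> 0" "k \<mu> * r = coeff (c - D B) (h \<mu>)"
      using coeff_lead[OF nz] \<mu> k by (auto simp: r_def)
    define B' where "B' = B + single \<mu> r"
    have \<mu>B: "\<mu> \<notin> supp B" using less by blast
    have suppB': "supp B' = insert \<mu> (supp B)"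
      using \<mu>B r(1) by (auto simp: B'_def in_supp_iff split: if_splits)
    have tr\<mu>: "trunc B' \<mu> = B"
      by (rule hahn_eqI) (use less \<mu>B in \<open>force simp: B'_def coeff_trunc in_supp_iff\<close>)
    have trx: "trunc B' x = trunc B x" if "x \<in> supp B" for x
      by (rule hahn_eqI) (use less[OF that] in \<open>auto simp: B'_def coeff_trunc\<close>)
    have "good B'"
      unfolding good_def
    proof (intro conjI ballI)
      show "supp B' \<subseteq> M" using suppB' BM \<mu>(1) by auto
      fix x assume x: "x \<in> supp B'"
      have c\<mu>: "coeff B' \<mu> = r" using \<mu>B by (simp add: B'_def in_supp_iff)
      have cx: "coeff B' x = coeff B x" if "x \<noteq> \<mu>" using that by (simp add: B'_def)
      show "D (trunc B' x) \<noteq> c" "lead (c - D (trunc B' x)) = h x"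
        "coeff (c - D (trunc B' x)) (h x) = k x * coeff B' x"
        using x suppB' DB \<mu>(2) r(2) c\<mu> cx tr\<mu> trx goodD[OF goodB]
        by (cases "x = \<mu>"; auto)+
    qed
    then have "\<mu> \<in> S" using suppB' by (auto simp: S_def)
    then show False using suppB \<mu>B by blast
  qed
  then show ?thesis using goodD(1)[OF goodB] by blast
qed

lemma hahn_inverse_exists:
  fixes a :: "'a::linordered_ab_group_add hahn"
  assumes "a \<noteq> 0"
  shows "\<exists>b. b * a = 1"
proof -
  have "\<exists>b. supp b \<subseteq> UNIV \<and> a * b = 1"
  proof (rule successive_approximation[where h = "\<lambda>x. lead a + x" and k = "\<lambda>_. coeff a (lead a)"])
    show "lead (1 - a * b) \<in> range ((+) (lead a))" for b
      by (rule image_eqI[of _ _ "lead (1 - a * b) - lead a"]) auto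
  qed (use assms in \<open>auto simp: algebra_simps strict_mono_on_def coeff_times_lead coeff_lead\<close>)
  then show ?thesis by (auto simp: mult.commute)
qed

instantiation hahn :: (linordered_ab_group_add) linordered_field
begin

definition inverse_hahn :: "'a hahn \<Rightarrow> 'a hahn" where
  "inverse (a::'a hahn) = (if a = 0 then 0 else THE b. b * a = 1)"

definition divide_hahn :: "'a hahn \<Rightarrow> 'a hahn \<Rightarrow> 'a hahn" where
  "(a::'a hahn) div b = (if b = 0 then 0 else THE c. c * b = a)"

definition abs_hahn :: "'a hahn \<Rightarrow> 'a hahn" where
  "\<bar>a::'a hahn\<bar> = (if a < 0 then - a else a)"

definition sgn_hahn :: "'a hahn \<Rightarrow> 'a hahn" where
  "sgn (a::'a hahn) = (if a = 0 then 0 else if 0 < a then 1 else - 1)"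

instance
proof
  fix a b c :: "'a hahn"
  show inv: "inverse a * a = 1" if nz: "a \<noteq> 0" for a :: "'a hahn"
  proof -
    have "\<exists>!b. b * a = 1"
      using hahn_inverse_exists[OF nz] nz by (metis mult_right_cancel)
    then have "(THE b. b * a = 1) * a = 1" by (rule theI')
    then show ?thesis using nz by (simp add: inverse_hahn_def)
  qed
  show "a div b = a * inverse b" 
  proof (cases "b = 0")
    case False
    have "(THE c. c * b = a) = a * inverse b"
    proof (rule the_equality)
      show "a * inverse b * b = a" using inv[OF False] by (simp add: mult.assoc)
      show "c = a * inverse b" if "c * b = a" for c
        using that inv[OF False] by (metis mult.assoc mult.commute mult_1_right)
    qed
    then show ?thesis using False by (simp add: divide_hahn_def)
  qed (simp add: divide_hahn_def inverse_hahn_def)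
  show "inverse (0::'a hahn) = 0" by (simp add: inverse_hahn_def)
  show "\<bar>a\<bar> = (if a < 0 then - a else a)" by (rule abs_hahn_def)
  show "sgn a = (if a = 0 then 0 else if 0 < a then 1 else - 1)" by (rule sgn_hahn_def)
  show "c * a < c * b" if "a < b" "0 < c"
  proof -
    have "lpos (b - a)" "lpos c" using that by (simp_all add: less_hahn_lpos)
    then have "lpos (c * (b - a))"
      by (auto simp: lpos_def coeff_times_lead)
    then show ?thesis by (simp add: less_hahn_lpos algebra_simps)
  qed
qed

end

text \<open>Applied to a set \<open>\<Phi>\<close> of fundamental monomials this is the Hahn group over \<open>\<Phi>\<close>; applied to a
  subgroup \<open>G\<close> of it, this is \<open>\<real>((G))\<close>.\<close>

definition series_over :: "'a::linorder set \<Rightarrow> 'a hahn set" where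
  "series_over S = {a. supp a \<subseteq> S}"

text \<open>Both embeddings, of \<open>\<Phi>\<close> into the Hahn group and of the monomials into the series. A fundamental
  monomial \<open>\<phi>\<close> is therefore \<open>mon (mon \<phi>)\<close> as a series.\<close>

definition mon :: "'a::linorder \<Rightarrow> 'a hahn" where
  "mon x = single x 1"

definition additive_subgroup :: "'g::linordered_ab_group_add set \<Rightarrow> bool" where
  "additive_subgroup G \<longleftrightarrow> 0 \<in> G \<and> (\<forall>\<alpha>\<in>G. \<forall>\<beta>\<in>G. \<alpha> + \<beta> \<in> G) \<and> (\<forall>\<alpha>\<in>G. - \<alpha> \<in> G)"

definition monomial_group :: "'p::linorder set \<Rightarrow> 'p hahn set \<Rightarrow> bool" where
  "monomial_group \<Phi> G \<longleftrightarrow> G \<subseteq> series_over \<Phi> \<and> additive_subgroup G \<and> mon ` \<Phi> \<subseteq> G"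

text \<open>Quotients formed in the field of all series over the Hahn group agree with those of the subfield
  \<open>\<real>((G))\<close>, by the following closure properties.\<close>

lemma series_over_inverse:
  assumes G: "additive_subgroup G" and a: "a \<in> series_over G"
  shows "inverse a \<in> series_over G"
proof (cases "a = 0")
  case False
  have "anti_well_ordered {x. (if x \<in> G then coeff (inverse a) x else 0) \<noteq> 0}"
    by (rule anti_well_ordered_subset[OF supp_anti_well_ordered[of "inverse a"]])
      (auto simp: in_supp_iff)
  note b_ex = coeff_Abs_hahn[OF this]
  define b where "b = Abs_hahn (\<lambda>x. if x \<in> G then coeff (inverse a) x else 0)"
  have b: "coeff b x = (if x \<in> G then coeff (inverse a) x else 0)" for x
    unfolding b_def by (rule b_ex)
  have "coeff (a * b) z = coeff 1 z" for z
  proof (cases "z \<in> G")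
    case True
    have diff: "z - x \<in> G" if "x \<in> supp a" for x
      using that a G True unfolding additive_subgroup_def series_over_def
      by (metis add_uminus_conv_diff mem_Collect_eq subsetD)
    have "coeff (a * b) z = coeff (a * inverse a) z"
      unfolding coeff_times by (rule sum.cong) (auto simp: in_supp_iff b diff[unfolded in_supp_iff])
    then show ?thesis using False by simp
  next
    case z: False
    have "x + y \<in> G" if "x \<in> supp a" "y \<in> supp b" for x y
      using that a G b unfolding additive_subgroup_def series_over_def
      by (metis in_supp_iff mem_Collect_eq subsetD)
    then have "z \<notin> supp (a * b)" using supp_times[of a b] z by blast
    moreover have "z \<noteq> 0" using z G by (auto simp: additive_subgroup_def)
    ultimately show ?thesis by (simp add: in_supp_iff coeff_one)
  qed
  then have "a * b = 1" by (rule hahn_eqI)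
  then have "inverse a = b" by (rule inverse_unique)
  moreover have "supp b \<subseteq> G" by (auto simp: in_supp_iff b split: if_splits)
  ultimately show ?thesis by (simp add: series_over_def)
qed (simp add: series_over_def supp_def)

lemma series_over_divide:
  assumes G: "additive_subgroup G" and a: "a \<in> series_over G" "b \<in> series_over G"
  shows "a / b \<in> series_over G"
proof -
  have "supp (a * inverse b) \<subseteq> G"
    using supp_times[of a "inverse b"] a series_over_inverse[OF G a(2)] G
    unfolding series_over_def additive_subgroup_def by blast
  then show ?thesis by (simp add: series_over_def divide_inverse)
qed

text \<open>\<open>None\<close> is the formal leading monomial \<open>0\<close> of the zero series, which lies below all monomials.\<close>

definition LM :: "'g::linorder hahn \<Rightarrow> 'g option" where
  "LM a = (if a = 0 then None else Some (lead a))"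

definition dominated_eq :: "'g::linorder hahn \<Rightarrow> 'g hahn \<Rightarrow> bool" (infix \<open>\<preceq>\<close> 50) where
  "a \<preceq> b \<longleftrightarrow> LM a \<le> LM b"

definition dominated :: "'g::linorder hahn \<Rightarrow> 'g hahn \<Rightarrow> bool" (infix \<open>\<prec>\<close> 50) where
  "a \<prec> b \<longleftrightarrow> LM a < LM b"

definition asymptotic :: "'g::linorder hahn \<Rightarrow> 'g hahn \<Rightarrow> bool" (infix \<open>\<asymp>\<close> 50) where
  "a \<asymp> b \<longleftrightarrow> LM a = LM b"

text \<open>Values are taken in the Hahn group because of the convention for the trivial monomial.\<close>

definition LF :: "'p::linorder hahn \<Rightarrow> 'p hahn" where
  "LF \<gamma> = (if \<gamma> = 0 then 0 else mon (lead \<gamma>))"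

text \<open>Only meaningful for \<open>a, b \<succ> 1\<close>; in particular both are nonzero.\<close>

definition comparable :: "'p::linorder hahn hahn \<Rightarrow> 'p hahn hahn \<Rightarrow> bool" where
  "comparable a b \<longleftrightarrow> LF (lead a) = LF (lead b)"

definition summable_family :: "('i \<Rightarrow> 'g::linorder hahn) \<Rightarrow> 'i set \<Rightarrow> bool" where
  "summable_family a I \<longleftrightarrow>
     anti_well_ordered (\<Union>i\<in>I. supp (a i)) \<and> (\<forall>\<alpha>. finite {i \<in> I. \<alpha> \<in> supp (a i)})"

text \<open>Only meaningful for summable families.\<close>

definition family_sum :: "('i \<Rightarrow> 'g::linorder hahn) \<Rightarrow> 'i set \<Rightarrow> 'g hahn" where
  "family_sum a I = Abs_hahn (\<lambda>\<alpha>. \<Sum>i\<in>{i \<in> I. \<alpha> \<in> supp (a i)}. coeff (a i) \<alpha>)"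

lemma coeff_family_sum:
  assumes "summable_family a I"
  shows "coeff (family_sum a I) \<alpha> = (\<Sum>i\<in>{i \<in> I. \<alpha> \<in> supp (a i)}. coeff (a i) \<alpha>)"
proof -
  have "anti_well_ordered {\<alpha>. (\<Sum>i\<in>{i \<in> I. \<alpha> \<in> supp (a i)}. coeff (a i) \<alpha>) \<noteq> 0}"
    by (rule anti_well_ordered_subset[of "\<Union>i\<in>I. supp (a i)"])
      (use assms in \<open>auto simp: summable_family_def elim!: sum.not_neutral_contains_not_neutral\<close>)
  then show ?thesis unfolding family_sum_def by (rule coeff_Abs_hahn)
qed

text \<open>\<open>d\<close> is a map on \<open>\<real>((G))\<close>; its values elsewhere are irrelevant.\<close>

definition series_derivation ::
    "'p::linorder hahn set \<Rightarrow> ('p hahn hahn \<Rightarrow> 'p hahn hahn) \<Rightarrow> bool" where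
  "series_derivation G d \<longleftrightarrow>
     (\<forall>a\<in>series_over G. d a \<in> series_over G) \<and>
     d 1 = 0 \<and>
     (\<forall>\<alpha>\<in>G. summable_family (\<lambda>\<phi>. d (mon (mon \<phi>)) / mon (mon \<phi>)) (supp \<alpha>) \<and>
        d (mon \<alpha>) = mon \<alpha> *
          family_sum (\<lambda>\<phi>. coeff \<alpha> \<phi> *\<^sub>R (d (mon (mon \<phi>)) / mon (mon \<phi>))) (supp \<alpha>)) \<and>
     (\<forall>a\<in>series_over G. summable_family (\<lambda>\<alpha>. d (mon \<alpha>)) (supp a) \<and>
        d a = family_sum (\<lambda>\<alpha>. coeff a \<alpha> *\<^sub>R d (mon \<alpha>)) (supp a))"

definition hardy_type ::
    "'p::linorder hahn set \<Rightarrow> ('p hahn hahn \<Rightarrow> 'p hahn hahn) \<Rightarrow> bool" where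
  "hardy_type G d \<longleftrightarrow>
     (\<forall>a\<in>series_over G. d a = 0 \<longleftrightarrow> a \<in> \<real>) \<and>
     (\<forall>a\<in>series_over G. \<forall>b\<in>series_over G.
        a \<noteq> 0 \<and> b \<noteq> 0 \<and> \<not> a \<asymp> 1 \<and> \<not> b \<asymp> 1 \<longrightarrow> (a \<preceq> b \<longleftrightarrow> d a \<preceq> d b)) \<and>
     (\<forall>a\<in>series_over G. \<forall>b\<in>series_over G.
        \<bar>b\<bar> \<prec> \<bar>a\<bar> \<and> 1 \<prec> \<bar>b\<bar> \<longrightarrow>
          d b / b \<preceq> d a / a \<and> (d a / a \<asymp> d b / b \<longleftrightarrow> comparable a b))"

text \<open>For a Hardy type derivation \<open>\<phi>'/\<phi>\<close> is nonzero, so \<open>lead\<close> is its leading monomial.\<close>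

definition theta :: "('p::linorder hahn hahn \<Rightarrow> 'p hahn hahn) \<Rightarrow> 'p \<Rightarrow> 'p hahn" where
  "theta d \<phi> = lead (d (mon (mon \<phi>)) / mon (mon \<phi>))"

definition is_glb_in :: "'g::order set \<Rightarrow> 'g set \<Rightarrow> 'g \<Rightarrow> bool" where
  "is_glb_in G T t \<longleftrightarrow>
     t \<in> G \<and> (\<forall>x\<in>T. t \<le> x) \<and> (\<forall>s\<in>G. (\<forall>x\<in>T. s \<le> x) \<longrightarrow> s \<le> t)"

definition admits_integral ::
    "'p::linorder hahn set \<Rightarrow> ('p hahn hahn \<Rightarrow> 'p hahn hahn) \<Rightarrow> 'p hahn hahn \<Rightarrow> bool" where
  "admits_integral G d a \<longleftrightarrow> (\<exists>b\<in>series_over G. b \<noteq> 0 \<and> d b = a)"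

end

theory Submission
  imports Defs
begin

text \<open>
  Write \<open>h \<alpha>\<close> for the leading monomial of \<open>\<alpha>'\<close>, where \<open>\<alpha> \<noteq> 1\<close> is a monomial. By (HD2), \<open>h\<close> is
  strictly increasing, so \<open>a'\<close> has leading monomial \<open>h (LM a)\<close> as soon as \<open>a \<noteq> 0\<close> has no constant term.
  Hence integrating \<open>c\<close> is a transfinite process: cancel the leading term of the current
  remainder \<open>c - b'\<close> by adding a term to \<open>b\<close>. This process, which is \<open>successive_approximation\<close>,
  only gets stuck at a remainder whose leading monomial lies outside the range of \<open>h\<close>, and
  everything reduces to the determination of that range.

  In additive notation, (D1) gives \<open>h \<alpha> = \<alpha> + \<theta> (LF \<alpha>)\<close>. The range of \<open>h\<close> turns out to be \<open>\<Gamma>\<close> without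
  the greatest lower bound of the values of \<open>\<theta>\<close> (\<open>range_lead_deriv\<close>). The key estimate is that
  \<open>\<theta> \<psi> - \<theta> \<phi>\<close> is infinitesimal compared with \<open>\<psi>\<close> when \<open>\<phi> < \<psi>\<close> (\<open>lead_theta_diff_less\<close>). Because of
  it, \<open>h \<alpha> = \<beta>\<close> has a solution as soon as some \<open>\<beta> - \<theta> \<psi>\<close> has a leading fundamental monomial \<open>\<chi> \<ge> \<psi>\<close>:
  replacing \<open>\<psi>\<close> by \<open>\<chi>\<close> does not change this leading monomial, and \<open>\<alpha> = \<beta> - \<theta> \<chi>\<close> is then a solution.
  Such a \<open>\<psi>\<close> exists both when \<open>\<beta>\<close> exceeds some value of \<open>\<theta>\<close> and when a positive gap separates \<open>\<beta>\<close>
  from all values.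

  Conversely, \<open>h \<alpha>\<close> is never the greatest lower bound. For \<open>\<alpha> \<succ> 1\<close> it exceeds \<open>\<theta> (LF \<alpha>)\<close>. For \<open>\<alpha> \<prec> 1\<close>
  it is a lower bound, but \<open>h (1/\<psi>)\<close> is a greater one for any fundamental monomial \<open>\<psi> < LF \<alpha>\<close>, and
  if there is no such \<open>\<psi>\<close>, then \<open>\<theta> (LF \<alpha>)\<close> is one.

  If there is no greatest lower bound, \<open>h\<close> is onto and every series has an integral. If \<open>t\<close> is the
  greatest lower bound, then the monomial \<open>t\<close> has no integral, but below \<open>t\<close> the process is never
  stuck, because its remainders stay below \<open>t\<close>.
\<close>

section \<open>Leading exponents\<close>

lemma lead_in_supp: "a \<noteq> 0 \<Longrightarrow> lead a \<in> supp a"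
  by (simp add: in_supp_iff coeff_lead)

lemma supp_le_lead: "x \<in> supp a \<Longrightarrow> x \<le> lead a"
  by (metis coeff_above_lead in_supp_iff coeff_simps(1) not_le)

lemma lead_uminus [simp]: "lead (- a) = lead a"
  by (simp add: lead_def supp_def)

lemma lead_add:
  assumes "a \<noteq> 0" "b = 0 \<or> lead b < lead a"
  shows "lead (a + b) = lead a"
proof (rule leadI)
  have b: "coeff b y = 0" if "lead a \<le> y" for y
    using assms(2) that supp_le_lead[of y b] by (force simp: in_supp_iff)
  show "coeff (a + b) (lead a) \<noteq> 0"
    using assms(1) b by (simp add: coeff_lead)
  show "coeff (a + b) y = 0" if "lead a < y" for y
    using assms(1) b that by (simp add: coeff_above_lead)
qed

lemma lead_mono:
  assumes "0 < a" "a \<le> b"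
  shows "lead a \<le> lead b"
proof (rule ccontr)
  assume *: "\<not> lead a \<le> lead b"
  have b: "0 < b" using assms by simp
  have "lead (a + - b) = lead a"
    by (rule lead_add) (use * assms in auto)
  moreover have "coeff b (lead a) = 0"
    using * b by (intro coeff_above_lead) auto
  ultimately have "0 < coeff (a - b) (lead (a - b))"
    using assms(1) by (simp add: hahn_pos_iff)
  then have "0 < a - b" by (auto simp: hahn_pos_iff)
  then show False using assms(2) by simp
qed

lemma pos_less_of_lead_less: "0 < a \<Longrightarrow> 0 < b \<Longrightarrow> lead a < lead b \<Longrightarrow> a < b"
  using lead_mono[of b a] by force

lemma mon_neq_0 [simp]: "mon x \<noteq> 0"
  by (metis coeff_simps(1,6) mon_def zero_neq_one)

lemma lead_mon [simp]: "lead (mon x) = x"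
  by (simp add: mon_def)

lemma supp_mon [simp]: "supp (mon x) = {x}"
  by (simp add: mon_def)

lemma mon_pos [simp]: "0 < mon x"
  by (simp add: hahn_pos_iff) (simp add: mon_def)

lemma mon_less_iff [simp]: "mon x < mon y \<longleftrightarrow> x < y"
proof
  show "x < y" if "mon x < mon y"
  proof (rule ccontr)
    assume "\<not> x < y"
    then consider "x = y" | "y < x" by force
    then show False
      using that pos_less_of_lead_less[of "mon y" "mon x"] by cases auto
  qed
qed (simp add: pos_less_of_lead_less)

lemma one_eq_mon: "1 = mon 0"
  by (simp add: one_hahn_def mon_def)

lemma LM_mon [simp]: "LM (mon x) = Some x"
  by (simp add: LM_def)

lemma mon_in_Reals_iff: "mon x \<in> \<real> \<longleftrightarrow> x = 0"
proof
  assume "mon x \<in> \<real>"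
  then obtain r where "mon x = of_real r" by (auto elim: Reals_cases)
  then have "coeff (mon x) x = coeff (single 0 r) x" by (simp add: of_real_hahn)
  then show "x = 0" by (simp add: mon_def split: if_splits)
qed (simp flip: one_eq_mon)

section \<open>Summable families\<close>

lemma coeff_family_sum_scaleR:
  assumes "summable_family f I" "\<And>i. i \<in> I \<Longrightarrow> c i \<noteq> 0"
  shows "coeff (family_sum (\<lambda>i. c i *\<^sub>R f i) I) x = (\<Sum>i\<in>{i \<in> I. x \<in> supp (f i)}. c i * coeff (f i) x)"
proof -
  have s: "supp (c i *\<^sub>R f i) = supp (f i)" if "i \<in> I" for i
    using assms(2)[OF that] by (auto simp: in_supp_iff)
  then have "summable_family (\<lambda>i. c i *\<^sub>R f i) I"
    using assms(1) by (simp add: summable_family_def cong: conj_cong)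
  then show ?thesis
    by (simp add: coeff_family_sum s cong: conj_cong)
qed

text \<open>The sum of a family whose leading exponents increase with the index is dominated by its last
  member. Both logarithmic derivatives of monomials and derivatives of series are sums of this kind.\<close>

lemma coeff_family_sum_lead:
  fixes f :: "'i::linorder \<Rightarrow> 'g::linorder hahn"
  assumes sum: "summable_family f I" and c: "\<And>i. i \<in> I \<Longrightarrow> c i \<noteq> 0"
    and mono: "strict_mono_on I (\<lambda>i. lead (f i))" and nz: "\<And>i. i \<in> I \<Longrightarrow> f i \<noteq> 0"
    and m: "m \<in> I" "\<And>i. i \<in> I \<Longrightarrow> i \<le> m"
  shows "coeff (family_sum (\<lambda>i. c i *\<^sub>R f i) I) (lead (f m)) = c m * coeff (f m) (lead (f m))"
    and "lead (f m) < x \<Longrightarrow> coeff (family_sum (\<lambda>i. c i *\<^sub>R f i) I) x = 0"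
proof -
  have le: "lead (f i) \<le> lead (f m)" if "i \<in> I" for i
    using that m mono by (metis order_le_less strict_mono_onD)
  have "i = m" if "i \<in> I" "lead (f m) \<in> supp (f i)" for i
  proof (rule ccontr)
    assume "i \<noteq> m"
    then have "lead (f i) < lead (f m)"
      using that m mono by (metis order_le_less strict_mono_onD)
    then show False using supp_le_lead[OF that(2)] by simp
  qed
  then have "{i \<in> I. lead (f m) \<in> supp (f i)} = {m}"
    using m nz by (auto simp: lead_in_supp)
  then show "coeff (family_sum (\<lambda>i. c i *\<^sub>R f i) I) (lead (f m)) = c m * coeff (f m) (lead (f m))"
    by (simp add: coeff_family_sum_scaleR[OF sum c])
  have "{i \<in> I. x \<in> supp (f i)} = {}" if "lead (f m) < x" for x
    using that le supp_le_lead by fastforce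
  then show "coeff (family_sum (\<lambda>i. c i *\<^sub>R f i) I) x = 0" if "lead (f m) < x"
    using that by (simp only: coeff_family_sum_scaleR[OF sum c] sum.empty)
qed

section \<open>Leading monomials of derivatives\<close>

locale hardy_series_derivation =
  fixes \<Phi> :: "'p::linorder set" and \<Gamma> :: "'p hahn set"
    and d :: "'p hahn hahn \<Rightarrow> 'p hahn hahn"
  assumes group: "monomial_group \<Phi> \<Gamma>"
    and series: "series_derivation \<Gamma> d"
    and hardy: "hardy_type \<Gamma> d"
begin

abbreviation "nontrivial \<equiv> \<Gamma> - {0}"

abbreviation "\<theta> \<equiv> theta d"

abbreviation "lead_deriv \<alpha> \<equiv> lead (d (mon \<alpha>))"

lemma additive_subgroup: "additive_subgroup \<Gamma>"
  using group by (simp add: monomial_group_def)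

lemma group_closed:
  "0 \<in> \<Gamma>" "\<alpha> \<in> \<Gamma> \<Longrightarrow> - \<alpha> \<in> \<Gamma>" "\<alpha> \<in> \<Gamma> \<Longrightarrow> \<beta> \<in> \<Gamma> \<Longrightarrow> \<alpha> + \<beta> \<in> \<Gamma>" "\<alpha> \<in> \<Gamma> \<Longrightarrow> \<beta> \<in> \<Gamma> \<Longrightarrow> \<alpha> - \<beta> \<in> \<Gamma>"
  using additive_subgroup unfolding additive_subgroup_def by (metis add_uminus_conv_diff)+

lemma fundamental_in_group: "\<phi> \<in> \<Phi> \<Longrightarrow> mon \<phi> \<in> \<Gamma>"
  using group by (auto simp: monomial_group_def)

lemma lead_fundamental: "\<alpha> \<in> nontrivial \<Longrightarrow> lead \<alpha> \<in> \<Phi>"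
  using group lead_in_supp by (auto simp: monomial_group_def series_over_def)

lemma supp_fundamental: "\<alpha> \<in> \<Gamma> \<Longrightarrow> supp \<alpha> \<subseteq> \<Phi>"
  using group by (auto simp: monomial_group_def series_over_def)

lemma mon_in_series: "\<alpha> \<in> \<Gamma> \<Longrightarrow> mon \<alpha> \<in> series_over \<Gamma>"
  by (simp add: series_over_def)

lemma lead_in_group: "a \<in> series_over \<Gamma> \<Longrightarrow> a \<noteq> 0 \<Longrightarrow> lead a \<in> \<Gamma>"
  using lead_in_supp by (auto simp: series_over_def)

lemma deriv_closed: "a \<in> series_over \<Gamma> \<Longrightarrow> d a \<in> series_over \<Gamma>"
  using series unfolding series_derivation_def by blast

lemma deriv_eq_0_iff: "a \<in> series_over \<Gamma> \<Longrightarrow> d a = 0 \<longleftrightarrow> a \<in> \<real>"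
  using hardy by (simp add: hardy_type_def)

lemma deriv_mon_neq_0: "\<alpha> \<in> nontrivial \<Longrightarrow> d (mon \<alpha>) \<noteq> 0"
  by (simp add: deriv_eq_0_iff mon_in_series mon_in_Reals_iff)

lemma lead_deriv_in_group: "\<alpha> \<in> nontrivial \<Longrightarrow> lead_deriv \<alpha> \<in> \<Gamma>"
  by (intro lead_in_group deriv_closed mon_in_series deriv_mon_neq_0) auto

lemma strict_mono_lead_deriv: "strict_mono_on nontrivial lead_deriv"
proof (rule strict_mono_onI)
  fix \<alpha> \<beta> assume "\<alpha> \<in> nontrivial" "\<beta> \<in> nontrivial" "\<alpha> < \<beta>"
  then have "\<not> mon \<beta> \<preceq> mon \<alpha>" "\<not> mon \<alpha> \<asymp> 1" "\<not> mon \<beta> \<asymp> 1"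
    "mon \<alpha> \<in> series_over \<Gamma>" "mon \<beta> \<in> series_over \<Gamma>"
    by (simp_all add: dominated_eq_def asymptotic_def one_eq_mon mon_in_series)
  then have "\<not> d (mon \<beta>) \<preceq> d (mon \<alpha>)"
    using hardy unfolding hardy_type_def by (metis mon_neq_0)
  then show "lead_deriv \<alpha> < lead_deriv \<beta>"
    using \<open>\<alpha> \<in> nontrivial\<close> \<open>\<beta> \<in> nontrivial\<close> deriv_mon_neq_0
    by (auto simp: dominated_eq_def LM_def)
qed

lemma lead_deriv_less: "\<alpha> \<in> nontrivial \<Longrightarrow> \<beta> \<in> nontrivial \<Longrightarrow> \<alpha> < \<beta> \<Longrightarrow> lead_deriv \<alpha> < lead_deriv \<beta>"
  by (rule strict_mono_onD[OF strict_mono_lead_deriv])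

lemma log_deriv_neq_0: "\<phi> \<in> \<Phi> \<Longrightarrow> d (mon (mon \<phi>)) / mon (mon \<phi>) \<noteq> 0"
  using deriv_mon_neq_0[of "mon \<phi>"] fundamental_in_group by simp

lemma theta_in_group: "\<phi> \<in> \<Phi> \<Longrightarrow> \<theta> \<phi> \<in> \<Gamma>"
  unfolding theta_def
  by (intro lead_in_group log_deriv_neq_0 series_over_divide additive_subgroup deriv_closed
      mon_in_series fundamental_in_group)

text \<open>Distinct fundamental monomials are not comparable, so (HD3) separates their logarithmic derivatives.\<close>

lemma strict_mono_theta: "strict_mono_on \<Phi> \<theta>"
proof (rule strict_mono_onI)
  fix \<phi> \<psi> assume \<phi>\<psi>: "\<phi> \<in> \<Phi>" "\<psi> \<in> \<Phi>" "\<phi> < \<psi>"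
  let ?a = "mon (mon \<psi>)" and ?b = "mon (mon \<phi>)"
  have abs: "\<bar>?a\<bar> = ?a" "\<bar>?b\<bar> = ?b" by (simp_all add: abs_of_pos)
  have "mon \<psi> \<noteq> mon \<phi>" using \<phi>\<psi>(3) by (metis lead_mon less_irrefl)
  then have "\<not> comparable ?a ?b" by (simp add: comparable_def LF_def)
  moreover have "?a \<in> series_over \<Gamma>" "?b \<in> series_over \<Gamma>"
    using \<phi>\<psi> by (simp_all add: mon_in_series fundamental_in_group)
  moreover have "\<bar>?b\<bar> \<prec> \<bar>?a\<bar>" "1 \<prec> \<bar>?b\<bar>"
    unfolding abs using \<phi>\<psi>(3) by (simp_all add: dominated_def one_eq_mon)
  ultimately have "d ?b / ?b \<preceq> d ?a / ?a" "\<not> d ?a / ?a \<asymp> d ?b / ?b"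
    using hardy unfolding hardy_type_def by blast+
  then show "\<theta> \<phi> < \<theta> \<psi>"
    using log_deriv_neq_0 \<phi>\<psi>
    by (auto simp: dominated_eq_def asymptotic_def LM_def theta_def)
qed

lemma theta_less: "\<phi> \<in> \<Phi> \<Longrightarrow> \<psi> \<in> \<Phi> \<Longrightarrow> \<phi> < \<psi> \<Longrightarrow> \<theta> \<phi> < \<theta> \<psi>"
  by (rule strict_mono_onD[OF strict_mono_theta])

lemma lead_deriv_eq:
  assumes "\<alpha> \<in> nontrivial"
  shows "lead_deriv \<alpha> = \<alpha> + \<theta> (lead \<alpha>)"
proof -
  let ?f = "\<lambda>\<phi>. d (mon (mon \<phi>)) / mon (mon \<phi>)"
  define L where "L = family_sum (\<lambda>\<phi>. coeff \<alpha> \<phi> *\<^sub>R ?f \<phi>) (supp \<alpha>)"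
  have \<alpha>: "\<alpha> \<in> \<Gamma>" "\<alpha> \<noteq> 0" using assms by auto
  have sum: "summable_family ?f (supp \<alpha>)" and prod: "d (mon \<alpha>) = mon \<alpha> * L"
    using series \<alpha> by (simp_all add: series_derivation_def L_def)
  have S: "supp \<alpha> \<subseteq> \<Phi>" using \<alpha> by (simp add: supp_fundamental)
  have mono: "strict_mono_on (supp \<alpha>) (\<lambda>\<phi>. lead (?f \<phi>))"
    using strict_mono_theta S by (force simp: strict_mono_on_def theta_def)
  have nz: "?f \<phi> \<noteq> 0" if "\<phi> \<in> supp \<alpha>" for \<phi>
    using that S log_deriv_neq_0 by blast
  have c: "coeff \<alpha> \<phi> \<noteq> 0" if "\<phi> \<in> supp \<alpha>" for \<phi>
    using that by (simp add: in_supp_iff)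
  note * = coeff_family_sum_lead[OF sum c mono nz lead_in_supp[OF \<alpha>(2)] supp_le_lead]
  have "lead L = \<theta> (lead \<alpha>)"
    unfolding theta_def
  proof (rule leadI)
    show "coeff L (lead (?f (lead \<alpha>))) \<noteq> 0"
      using *(1) c nz lead_in_supp[OF \<alpha>(2)] by (simp add: L_def coeff_lead)
    show "coeff L y = 0" if "lead (?f (lead \<alpha>)) < y" for y
      using *(2) that by (simp add: L_def)
  qed
  moreover have "L \<noteq> 0" using deriv_mon_neq_0[OF assms] prod by auto
  ultimately show ?thesis by (simp add: prod coeff_times_lead(3))
qed

lemma
  assumes b: "supp b \<subseteq> nontrivial" "b \<noteq> 0"
  shows coeff_deriv_lead:
      "coeff (d b) (lead_deriv (lead b)) = coeff (d (mon (lead b))) (lead_deriv (lead b)) * coeff b (lead b)"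
    and coeff_deriv_above: "lead_deriv (lead b) < y \<Longrightarrow> coeff (d b) y = 0"
proof -
  have sum: "summable_family (\<lambda>\<alpha>. d (mon \<alpha>)) (supp b)"
    and db: "d b = family_sum (\<lambda>\<alpha>. coeff b \<alpha> *\<^sub>R d (mon \<alpha>)) (supp b)"
    using series b by (auto simp: series_derivation_def series_over_def)
  have mono: "strict_mono_on (supp b) lead_deriv"
    using strict_mono_lead_deriv b(1) by (fastforce simp: strict_mono_on_def)
  have nz: "d (mon \<alpha>) \<noteq> 0" if "\<alpha> \<in> supp b" for \<alpha>
    using that b(1) deriv_mon_neq_0 by blast
  have c: "coeff b \<alpha> \<noteq> 0" if "\<alpha> \<in> supp b" for \<alpha>
    using that by (simp add: in_supp_iff)
  note * = coeff_family_sum_lead[OF sum c mono nz lead_in_supp[OF b(2)] supp_le_lead]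
  show "coeff (d b) (lead_deriv (lead b)) = coeff (d (mon (lead b))) (lead_deriv (lead b)) * coeff b (lead b)"
    using *(1) by (simp add: db mult.commute)
  show "lead_deriv (lead b) < y \<Longrightarrow> coeff (d b) y = 0"
    using *(2) by (simp add: db)
qed

lemma lead_deriv_series:
  assumes "supp b \<subseteq> nontrivial" "b \<noteq> 0"
  shows "lead (d b) = lead_deriv (lead b)"
proof (rule leadI)
  have "lead b \<in> nontrivial" using lead_in_supp assms by blast
  then show "coeff (d b) (lead_deriv (lead b)) \<noteq> 0"
    using assms(2) by (simp add: coeff_deriv_lead[OF assms] coeff_lead deriv_mon_neq_0)
qed (rule coeff_deriv_above[OF assms])

lemma deriv_add:
  assumes "a \<in> series_over \<Gamma>" "b \<in> series_over \<Gamma>"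
  shows "d (a + b) = d a + d b"
proof (rule hahn_eqI)
  fix x
  let ?F = "\<lambda>S. {\<alpha> \<in> S. x \<in> supp (d (mon \<alpha>))}"
  let ?U = "?F (supp a \<union> supp b)"
  have fin: "finite (?F (supp c))" if "c \<in> series_over \<Gamma>" for c
    using series that by (simp add: series_derivation_def summable_family_def)
  have U: "?U = ?F (supp a) \<union> ?F (supp b)" by blast
  have finU: "finite ?U"
    unfolding U using fin assms by blast
  have eq: "coeff (d c) x = (\<Sum>\<alpha>\<in>?U. coeff c \<alpha> * coeff (d (mon \<alpha>)) x)"
    if c: "c \<in> series_over \<Gamma>" and sub: "supp c \<subseteq> supp a \<union> supp b" for c
  proof -
    have "summable_family (\<lambda>\<alpha>. d (mon \<alpha>)) (supp c)"
      and "d c = family_sum (\<lambda>\<alpha>. coeff c \<alpha> *\<^sub>R d (mon \<alpha>)) (supp c)"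
      using series c by (simp_all add: series_derivation_def)
    then have "coeff (d c) x = (\<Sum>\<alpha>\<in>?F (supp c). coeff c \<alpha> * coeff (d (mon \<alpha>)) x)"
      using coeff_family_sum_scaleR[of "\<lambda>\<alpha>. d (mon \<alpha>)" "supp c" "coeff c"] by (simp add: in_supp_iff)
    also have "\<dots> = (\<Sum>\<alpha>\<in>?U. coeff c \<alpha> * coeff (d (mon \<alpha>)) x)"
      by (rule sum.mono_neutral_left[OF finU]) (use sub in \<open>auto simp: in_supp_iff\<close>)
    finally show ?thesis .
  qed
  have sub: "supp (a + b) \<subseteq> supp a \<union> supp b" by (auto simp: in_supp_iff)
  then have "a + b \<in> series_over \<Gamma>" using assms by (auto simp: series_over_def)
  then show "coeff (d (a + b)) x = coeff (d a + d b) x"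
    using eq[OF _ sub] eq[OF assms(1)] eq[OF assms(2)]
    by (simp add: sum.distrib algebra_simps)
qed

section \<open>The range of leading monomials of derivatives\<close>

text \<open>If \<open>lead \<alpha> \<le> \<phi>\<close>, this is the monotonicity of \<open>\<theta>\<close>. Otherwise \<open>\<alpha> < - mon \<phi>\<close>, and the monotonicity of
  \<open>lead_deriv\<close> reduces the claim to \<open>\<alpha> = - mon \<phi>\<close>.\<close>

lemma lead_deriv_neg_less_theta:
  assumes "\<alpha> \<in> \<Gamma>" "\<alpha> < 0" "\<phi> \<in> \<Phi>"
  shows "lead_deriv \<alpha> < \<theta> \<phi>"
proof (cases "lead \<alpha> \<le> \<phi>")
  case True
  have \<alpha>: "\<alpha> \<in> nontrivial" using assms by auto
  have "\<theta> (lead \<alpha>) \<le> \<theta> \<phi>"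
    using True theta_less[OF lead_fundamental[OF \<alpha>] assms(3)] by (auto simp: order_le_less)
  moreover have "\<alpha> + \<theta> (lead \<alpha>) < \<theta> (lead \<alpha>)" using assms(2) by simp
  ultimately show ?thesis
    unfolding lead_deriv_eq[OF \<alpha>] by (rule order_less_le_trans[rotated])
next
  case False
  have \<alpha>: "\<alpha> \<in> nontrivial" and \<phi>: "- mon \<phi> \<in> nontrivial"
    using assms by (auto simp: fundamental_in_group group_closed)
  have "mon \<phi> < - \<alpha>"
    using False assms(2) by (simp add: pos_less_of_lead_less)
  then have "\<alpha> < - mon \<phi>" by (subst less_minus_iff)
  then have "lead_deriv \<alpha> < - mon \<phi> + \<theta> \<phi>"
    using lead_deriv_less[OF \<alpha> \<phi>] lead_deriv_eq[OF \<phi>] by simp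
  also have "\<dots> < \<theta> \<phi>" by simp
  finally show ?thesis .
qed

text \<open>Let \<open>\<delta> = \<theta> \<psi> - \<theta> \<phi>\<close>. Since \<open>lead_deriv (- mon \<psi>) < \<theta> \<phi>\<close>, the monomial \<open>\<delta>\<close> lies below \<open>mon \<psi>\<close>. If its
  leading fundamental monomial were \<open>\<psi>\<close> itself, then \<open>lead_deriv\<close> would send \<open>- \<delta>\<close> to \<open>\<theta> \<psi> - \<delta> = \<theta> \<phi>\<close>,
  which is too large. The test element is \<open>\<delta>\<close> because \<open>\<Gamma>\<close> may lack small real powers of \<open>\<psi>\<close>.\<close>

lemma lead_theta_diff_less:
  assumes "\<phi> \<in> \<Phi>" "\<psi> \<in> \<Phi>" "\<phi> < \<psi>"
  shows "lead (\<theta> \<psi> - \<theta> \<phi>) < \<psi>"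
proof -
  define \<delta> where "\<delta> = \<theta> \<psi> - \<theta> \<phi>"
  have \<delta>: "\<delta> \<in> \<Gamma>" "0 < \<delta>"
    using assms theta_less by (simp_all add: \<delta>_def theta_in_group group_closed)
  have "lead \<delta> \<noteq> \<psi>"
  proof
    assume "lead \<delta> = \<psi>"
    moreover have "- \<delta> \<in> nontrivial" using \<delta> by (auto simp: group_closed)
    ultimately have "lead_deriv (- \<delta>) = - \<delta> + \<theta> \<psi>" by (simp add: lead_deriv_eq)
    then have "lead_deriv (- \<delta>) = \<theta> \<phi>" by (simp add: \<delta>_def)
    then show False
      using lead_deriv_neg_less_theta[of "- \<delta>" \<phi>] \<delta> assms(1) by (simp add: group_closed)
  qed
  moreover have "lead \<delta> \<le> \<psi>"
  proof -
    have "- mon \<psi> + \<theta> \<psi> < \<theta> \<phi>"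
      using lead_deriv_neg_less_theta[of "- mon \<psi>" \<phi>] lead_deriv_eq[of "- mon \<psi>"] assms
      by (simp add: group_closed fundamental_in_group)
    then have "\<delta> \<le> mon \<psi>" by (simp add: \<delta>_def algebra_simps)
    then show ?thesis using lead_mono[OF \<delta>(2)] by fastforce
  qed
  ultimately show ?thesis by (simp add: \<delta>_def)
qed

text \<open>For \<open>\<chi> = lead (\<beta> - \<theta> \<psi>)\<close>, the correction \<open>\<theta> \<chi> - \<theta> \<psi>\<close> is too small to move the leading
  fundamental monomial, so \<open>\<beta> - \<theta> \<chi>\<close> is a preimage of \<open>\<beta>\<close>.\<close>

lemma in_range_lead_deriv:
  assumes \<beta>: "\<beta> \<in> \<Gamma>" and \<psi>: "\<psi> \<in> \<Phi>" and nz: "\<beta> \<noteq> \<theta> \<psi>" and le: "\<psi> \<le> lead (\<beta> - \<theta> \<psi>)"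
  shows "\<beta> \<in> lead_deriv ` nontrivial"
proof -
  define \<chi> where "\<chi> = lead (\<beta> - \<theta> \<psi>)"
  have nt: "\<beta> - \<theta> \<psi> \<in> nontrivial"
    using \<beta> \<psi> nz by (simp add: group_closed theta_in_group)
  then have \<chi>: "\<chi> \<in> \<Phi>" unfolding \<chi>_def by (rule lead_fundamental)
  have diff: "\<beta> - \<theta> \<chi> = (\<beta> - \<theta> \<psi>) + - (\<theta> \<chi> - \<theta> \<psi>)" by simp
  have small: "- (\<theta> \<chi> - \<theta> \<psi>) = 0 \<or> lead (- (\<theta> \<chi> - \<theta> \<psi>)) < lead (\<beta> - \<theta> \<psi>)"
    using lead_theta_diff_less[OF \<psi> \<chi>] le lead_uminus[of "\<theta> \<chi> - \<theta> \<psi>"]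
    by (auto simp: \<chi>_def[symmetric] order_le_less simp del: lead_uminus)
  have lead: "lead (\<beta> - \<theta> \<chi>) = \<chi>"
    unfolding diff using lead_add[OF _ small] nz by (simp add: \<chi>_def)
  have "\<beta> \<noteq> \<theta> \<chi>"
    using small nz by (auto simp del: minus_diff_eq)
  then have \<gamma>: "\<beta> - \<theta> \<chi> \<in> nontrivial"
    using \<beta> \<chi> by (simp add: group_closed theta_in_group)
  then have "\<beta> = lead_deriv (\<beta> - \<theta> \<chi>)"
    by (simp add: lead_deriv_eq lead)
  then show ?thesis using \<gamma> by blast
qed

lemma in_range_lead_deriv_if_not_glb:
  assumes \<beta>: "\<beta> \<in> \<Gamma>" and not_glb: "\<not> is_glb_in \<Gamma> (\<theta> ` \<Phi>) \<beta>"
  shows "\<beta> \<in> lead_deriv ` nontrivial"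
proof (cases "\<exists>\<phi>\<in>\<Phi>. \<theta> \<phi> < \<beta>")
  case True
  then obtain \<phi> where \<phi>: "\<phi> \<in> \<Phi>" "\<theta> \<phi> < \<beta>" by blast
  define \<psi> where "\<psi> = lead (\<beta> - \<theta> \<phi>)"
  show ?thesis
  proof (cases "\<phi> \<le> \<psi>")
    case True
    then show ?thesis using in_range_lead_deriv[OF \<beta> \<phi>(1)] \<phi>(2) by (auto simp: \<psi>_def)
  next
    case False
    have \<psi>: "\<psi> \<in> \<Phi>"
      unfolding \<psi>_def using \<beta> \<phi> by (intro lead_fundamental) (auto simp: group_closed theta_in_group)
    have less: "\<theta> \<psi> < \<theta> \<phi>" using False theta_less[OF \<psi> \<phi>(1)] by simp
    \<comment> \<open>passing from \<open>\<phi>\<close> down to \<open>\<psi>\<close> only increases the distance to \<open>\<beta>\<close>\<close>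
    then have "\<psi> \<le> lead (\<beta> - \<theta> \<psi>)"
      using lead_mono[of "\<beta> - \<theta> \<phi>" "\<beta> - \<theta> \<psi>"] \<phi>(2) by (simp add: \<psi>_def)
    then show ?thesis using in_range_lead_deriv[OF \<beta> \<psi>] less \<phi>(2) by simp
  qed
next
  case False
  then obtain s where s: "s \<in> \<Gamma>" "\<beta> < s" "\<And>\<phi>. \<phi> \<in> \<Phi> \<Longrightarrow> s \<le> \<theta> \<phi>"
    using \<beta> not_glb by (auto simp: is_glb_in_def not_le not_less)
  define \<psi> where "\<psi> = lead (s - \<beta>)"
  have \<psi>: "\<psi> \<in> \<Phi>"
    unfolding \<psi>_def using \<beta> s by (intro lead_fundamental) (auto simp: group_closed)
  have "lead (s - \<beta>) \<le> lead (\<theta> \<psi> - \<beta>)"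
    using s(2) s(3)[OF \<psi>] by (intro lead_mono) auto
  then have "\<psi> \<le> lead (\<beta> - \<theta> \<psi>)"
    using lead_uminus[of "\<beta> - \<theta> \<psi>"] by (simp add: \<psi>_def)
  then show ?thesis using in_range_lead_deriv[OF \<beta> \<psi>] s(2) s(3)[OF \<psi>] by simp
qed

lemma lead_deriv_not_glb:
  assumes \<alpha>: "\<alpha> \<in> nontrivial"
  shows "\<not> is_glb_in \<Gamma> (\<theta> ` \<Phi>) (lead_deriv \<alpha>)"
proof
  assume glb: "is_glb_in \<Gamma> (\<theta> ` \<Phi>) (lead_deriv \<alpha>)"
  have \<phi>: "lead \<alpha> \<in> \<Phi>" using \<alpha> by (rule lead_fundamental)
  have "lead_deriv \<alpha> \<le> \<theta> (lead \<alpha>)" using glb \<phi> by (auto simp: is_glb_in_def)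
  then have neg: "\<alpha> < 0" using \<alpha> by (simp add: lead_deriv_eq order_le_less)
  have "\<exists>s\<in>\<Gamma>. lead_deriv \<alpha> < s \<and> (\<forall>\<psi>\<in>\<Phi>. s \<le> \<theta> \<psi>)"
  proof (cases "\<exists>\<psi>\<in>\<Phi>. \<psi> < lead \<alpha>")
    case True
    then obtain \<psi> where \<psi>: "\<psi> \<in> \<Phi>" "\<psi> < lead \<alpha>" by blast
    have "mon \<psi> < - \<alpha>" using \<psi> neg by (simp add: pos_less_of_lead_less)
    then have "\<alpha> < - mon \<psi>" by (subst less_minus_iff)
    moreover have \<gamma>: "- mon \<psi> \<in> nontrivial"
      using \<psi> by (simp add: group_closed fundamental_in_group)
    ultimately have "lead_deriv \<alpha> < lead_deriv (- mon \<psi>)" by (intro lead_deriv_less[OF \<alpha>])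
    moreover have "lead_deriv (- mon \<psi>) \<le> \<theta> \<chi>" if "\<chi> \<in> \<Phi>" for \<chi>
      using lead_deriv_neg_less_theta[OF _ _ that, of "- mon \<psi>"] \<gamma> by simp
    ultimately show ?thesis using lead_deriv_in_group[OF \<gamma>] by blast
  next
    case False
    \<comment> \<open>\<open>lead \<alpha>\<close> is the least fundamental monomial, and its \<open>\<theta>\<close> is the greatest lower bound\<close>
    then have "\<theta> (lead \<alpha>) \<le> \<theta> \<psi>" if "\<psi> \<in> \<Phi>" for \<psi>
      using that theta_less[OF \<phi> that] by (metis linorder_neqE order_le_less)
    then show ?thesis
      using \<phi> \<alpha> neg theta_in_group by (intro bexI[of _ "\<theta> (lead \<alpha>)"]) (auto simp: lead_deriv_eq)
  qed
  then show False using glb by (auto simp: is_glb_in_def)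
qed

lemma range_lead_deriv: "lead_deriv ` nontrivial = {\<beta> \<in> \<Gamma>. \<not> is_glb_in \<Gamma> (\<theta> ` \<Phi>) \<beta>}"
  using in_range_lead_deriv_if_not_glb lead_deriv_not_glb lead_deriv_in_group by blast

section \<open>Integration\<close>

text \<open>Downward closure of \<open>B\<close> keeps the remainders of the successive approximation in \<open>B\<close>. The approximations
  themselves use only monomials whose derivative has its leading monomial in \<open>B\<close>.\<close>

lemma admits_integral_if_lead_in_range:
  assumes B: "B \<subseteq> lead_deriv ` nontrivial"
    and down: "\<And>\<beta> \<gamma>. \<beta> \<in> B \<Longrightarrow> \<gamma> \<in> \<Gamma> \<Longrightarrow> \<gamma> \<le> \<beta> \<Longrightarrow> \<gamma> \<in> B"
    and c: "c \<in> series_over \<Gamma>" "c \<noteq> 0 \<Longrightarrow> lead c \<in> B"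
  shows "admits_integral \<Gamma> d c"
proof (cases "c = 0")
  case True
  have "d 1 = 0" "1 \<in> series_over \<Gamma>"
    using series mon_in_series[of 0] by (simp_all add: series_derivation_def one_eq_mon group_closed)
  then show ?thesis using True by (auto simp: admits_integral_def intro!: bexI[of _ 1])
next
  case False
  define M where "M = {\<alpha> \<in> nontrivial. lead_deriv \<alpha> \<in> B}"
  have MG: "b \<in> series_over \<Gamma>" "supp b \<subseteq> nontrivial" if "supp b \<subseteq> M" for b
    using that by (auto simp: M_def series_over_def)
  have "\<exists>b. supp b \<subseteq> M \<and> d b = c"
  proof (rule successive_approximation[where h = lead_deriv and k = "\<lambda>\<alpha>. coeff (d (mon \<alpha>)) (lead_deriv \<alpha>)"])
    show "d (a + b) = d a + d b" if "supp a \<subseteq> M" "supp b \<subseteq> M" for a b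
      using that MG by (intro deriv_add)
    show "strict_mono_on M lead_deriv"
      using strict_mono_lead_deriv by (auto simp: M_def strict_mono_on_def)
    show "coeff (d (mon \<alpha>)) (lead_deriv \<alpha>) \<noteq> 0" if "\<alpha> \<in> M" for \<alpha>
      using that by (intro coeff_lead deriv_mon_neq_0) (simp add: M_def)
    show "coeff (d b) (lead_deriv (lead b)) = coeff (d (mon (lead b))) (lead_deriv (lead b)) * coeff b (lead b)"
      if "supp b \<subseteq> M" "b \<noteq> 0" for b
      using that MG by (intro coeff_deriv_lead)
    show "coeff (d b) y = 0" if "supp b \<subseteq> M" "b \<noteq> 0" "lead_deriv (lead b) < y" for b y
      using that MG by (intro coeff_deriv_above)
    show "lead (c - d b) \<in> lead_deriv ` M" if b: "supp b \<subseteq> M" "d b \<noteq> c" for b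
    proof -
      let ?\<rho> = "lead (c - d b)"
      have "?\<rho> \<in> supp (c - d b)" using b(2) by (intro lead_in_supp) simp
      then have \<rho>: "?\<rho> \<in> supp c \<or> ?\<rho> \<in> supp (d b)" by (auto simp: in_supp_iff)
      moreover have "?\<rho> \<in> \<Gamma>"
        using \<rho> c(1) deriv_closed[OF MG(1)[OF b(1)]] by (auto simp: series_over_def)
      moreover have "lead (d b) \<in> B" if "?\<rho> \<in> supp (d b)"
      proof -
        have "d 0 = 0" by (simp add: deriv_eq_0_iff series_over_def supp_def)
        then have "b \<noteq> 0" using that by (auto simp: in_supp_iff)
        then show ?thesis
          using lead_deriv_series[OF MG(2)[OF b(1)]] lead_in_supp[of b] b(1) by (auto simp: M_def)
      qed
      ultimately have "?\<rho> \<in> B"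
        using down c(2)[OF False] supp_le_lead by blast
      moreover from this obtain \<alpha> where "\<alpha> \<in> nontrivial" "?\<rho> = lead_deriv \<alpha>" using B by blast
      ultimately show ?thesis by (auto simp: M_def)
    qed
  qed
  then obtain b where b: "supp b \<subseteq> M" "d b = c" by blast
  moreover have "b \<noteq> 0"
    using b(2) False deriv_eq_0_iff[of 0] by (auto simp: series_over_def supp_def)
  ultimately show ?thesis using MG(1) by (auto simp: admits_integral_def)
qed

text \<open>An integral can be chosen without constant term, and then \<open>lead_deriv_series\<close> applies to it.\<close>

lemma integrable_lead_in_range:
  assumes "admits_integral \<Gamma> d c" "c \<noteq> 0"
  shows "lead c \<in> lead_deriv ` nontrivial"
proof -
  obtain b where b: "b \<in> series_over \<Gamma>" "d b = c"
    using assms(1) by (auto simp: admits_integral_def)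
  define r :: "'p hahn hahn" where "r = single 0 (coeff b 0)"
  define e where "e = b - r"
  have r: "r \<in> series_over \<Gamma>" "d r = 0"
  proof -
    show "r \<in> series_over \<Gamma>"
      by (auto simp: r_def series_over_def in_supp_iff group_closed split: if_splits)
    then show "d r = 0" by (simp add: deriv_eq_0_iff) (simp add: r_def flip: of_real_hahn)
  qed
  have e: "supp e \<subseteq> nontrivial"
    using b(1) by (auto simp: e_def r_def series_over_def in_supp_iff split: if_splits)
  then have "d (e + r) = d e + d r"
    using r(1) by (intro deriv_add) (auto simp: series_over_def)
  then have de: "d e = c" using b r by (simp add: e_def)
  then have "e \<noteq> 0"
    using assms(2) deriv_eq_0_iff[of 0] by (auto simp: series_over_def supp_def)
  then show ?thesis
    using lead_deriv_series[OF e] lead_in_supp[of e] e by (auto simp: de)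
qed

end

theorem corollary6p4:
  fixes \<Phi> :: "'p::linorder set" and \<Gamma> :: "'p hahn set"
    and d :: "'p hahn hahn \<Rightarrow> 'p hahn hahn"
  assumes "monomial_group \<Phi> \<Gamma>"
    and "series_derivation \<Gamma> d"
    and "hardy_type \<Gamma> d"
  shows "(\<forall>\<theta>. is_glb_in \<Gamma> (theta d ` \<Phi>) \<theta> \<longrightarrow>
            (\<forall>a\<in>series_over \<Gamma>. a \<prec> mon \<theta> \<longrightarrow> admits_integral \<Gamma> d a)) \<and>
         ((\<forall>a\<in>series_over \<Gamma>. admits_integral \<Gamma> d a) \<longleftrightarrow>
            \<not> (\<exists>\<theta>. is_glb_in \<Gamma> (theta d ` \<Phi>) \<theta>))"
proof -
  interpret hardy_series_derivation \<Phi> \<Gamma> d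
    using assms by unfold_locales
  let ?T = "theta d ` \<Phi>"
  have below: "admits_integral \<Gamma> d a"
    if glb: "is_glb_in \<Gamma> ?T t" and a: "a \<in> series_over \<Gamma>" "a \<prec> mon t" for t a
  proof (rule admits_integral_if_lead_in_range[of "{\<beta> \<in> \<Gamma>. \<beta> < t}"])
    show "{\<beta> \<in> \<Gamma>. \<beta> < t} \<subseteq> lead_deriv ` nontrivial"
      unfolding range_lead_deriv using glb by (auto simp: is_glb_in_def)
    show "lead a \<in> {\<beta> \<in> \<Gamma>. \<beta> < t}" if "a \<noteq> 0"
      using a that by (auto simp: dominated_def LM_def lead_in_group)
  qed (use a in auto)
  have none: "admits_integral \<Gamma> d a"
    if "\<not> (\<exists>t. is_glb_in \<Gamma> ?T t)" "a \<in> series_over \<Gamma>" for a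
    by (rule admits_integral_if_lead_in_range[of \<Gamma>])
      (use that in \<open>auto simp: range_lead_deriv lead_in_group\<close>)
  have "\<not> admits_integral \<Gamma> d (mon t)" if "is_glb_in \<Gamma> ?T t" for t
    using that integrable_lead_in_range[of "mon t"] unfolding range_lead_deriv by auto
  moreover have "mon t \<in> series_over \<Gamma>" if "is_glb_in \<Gamma> ?T t" for t
    using that mon_in_series by (simp add: is_glb_in_def)
  ultimately show ?thesis using below none by blast
qed

end
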